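(* Let $E$ be a complex Banach space, $U\subset E$ a non-empty balanced open subset, and $w$ a radial weight on $U$ such that $\mathcal{P}(E)\subset\mathcal{H}_w(U)$. Then the following assertions are equivalent: (a) $E$ has the compact approximation property. (b) $I_U\in\overline{\mathcal{H}_w^c(U,E)}^{\tau_{\mathcal{M}}}$, where $I_U:U\to E$ is the inclusion mapping.
   Context: All Banach spaces are complex. $\mathcal{P}(E)$ is the space of continuous scalar-valued polynomials on $E$ (finite sums of continuous homogeneous polynomials, constants included); the inclusion $\mathcal{P}(E)\subset\mathcal{H}_w(U)$ refers to restrictions to $U$. $\mathcal{H}(U,F)$ is the space of holomorphic maps $U\to F$. A set $A\subset U$ is $U$-bounded if it is bounded and there is a neighborhood $V$ of $0$ with $A+V\subset U$. A weight $w$ on $U$ is a continuous strictly positive function on $U$ with $0<\inf_A w\le\sup_A w<\infty$ for every $U$-bounded set $A$. A weight on a balanced open set $U$ is radial if $w(tx)=w(x)$ for all $x\in U$ and $t\in\mathbb{C}$ with $|t|=1$. $\mathcal{H}_w(U,F)=\{f\in\mathcal{H}(U,F):\|f\|_w=\sup_{x\in U}w(x)\|f(x)\|<\infty\}$; $\mathcal{H}_w(U)=\mathcal{H}_w(U,\mathbb{C})$. $\mathcal{H}_w^c(U,F)$ is the set of $f\in\mathcal{H}_w(U,F)$ such that $wf:x\mapsto w(x)f(x)$ has relatively compact range in $F$. $\tau_{\mathcal{M}}$ is the locally convex topology on $\mathcal{H}_w(U,F)$ generated by the seminorms $p_{\bar\alpha,\bar A}(f)=\sup_{j\in\mathbb{N}}\big(\alpha_j\inf_{x\in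 A_j}w(x)\sup_{y\in A_j}\|f(y)\|\big)$, where $\bar\alpha=(\alpha_j)$ ranges over the null sequences of non-negative reals ($c_0^+$) and $\bar A=(A_j)$ over sequences of non-empty finite subsets of $U$. $E$ has the compact approximation property (CAP) if for every compact $K\subset E$ and $\epsilon>0$ there is a compact linear operator $T:E\to E$ with $\sup_{x\in K}\|T(x)-x\|<\epsilon$. *)

theory Defs
  imports "HOL-Analysis.Analysis"
begin

class complex_banach = banach +
  fixes scaleC :: "complex \<Rightarrow> 'a \<Rightarrow> 'a"  (infixr "*\<^sub>C" 75)
  assumes scaleC_add_right: "c *\<^sub>C (x + y) = c *\<^sub>C x + c *\<^sub>C y"
    and scaleC_add_left: "(c + d) *\<^sub>C x = c *\<^sub>C x + d *\<^sub>C x"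
    and scaleC_scaleC: "c *\<^sub>C (d *\<^sub>C x) = (c * d) *\<^sub>C x"
    and scaleC_of_real: "complex_of_real r *\<^sub>C x = r *\<^sub>R x"
    and norm_scaleC: "norm (c *\<^sub>C x) = cmod c * norm x"

instantiation complex :: complex_banach
begin

definition scaleC_complex :: "complex \<Rightarrow> complex \<Rightarrow> complex"
  where "scaleC_complex c z = c * z"

instance
  by standard
    (simp_all add: scaleC_complex_def algebra_simps norm_mult scaleR_conv_of_real)

end

definition complex_linear :: "('a::complex_banach \<Rightarrow> 'b::complex_banach) \<Rightarrow> bool"
  where "complex_linear T \<longleftrightarrow>
    (\<forall>x y. T (x + y) = T x + T y) \<and> (\<forall>c x. T (c *\<^sub>C x) = c *\<^sub>C T x)"

definition relatively_compact :: "'a::metric_space set \<Rightarrow> bool"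
  where "relatively_compact S \<longleftrightarrow> compact (closure S)"

definition compact_operator :: "('a::complex_banach \<Rightarrow> 'b::complex_banach) \<Rightarrow> bool"
  where "compact_operator T \<longleftrightarrow> complex_linear T \<and> relatively_compact (T ` cball 0 1)"

text \<open>The case of empty \<open>K\<close> is trivial under the convention that the supremum of the
  empty set of norms is 0; it is left out because \<open>Sup {}\<close> is unspecified on the reals.\<close>

definition compact_approximation_property :: "'a::complex_banach itself \<Rightarrow> bool"
  where "compact_approximation_property _ \<longleftrightarrow>
    (\<forall>K :: 'a set. \<forall>\<epsilon>>0. compact K \<and> K \<noteq> {} \<longrightarrow>
      (\<exists>T :: 'a \<Rightarrow> 'a. compact_operator T \<and> (SUP x\<in>K. norm (T x - x)) < \<epsilon>))"

text \<open>Elements of \<open>E\<^sup>m\<close> are lists of length \<open>m\<close>; values of the map on lists of other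
  lengths are irrelevant.\<close>

definition multilinear :: "nat \<Rightarrow> ('a::complex_banach list \<Rightarrow> 'b::complex_banach) \<Rightarrow> bool"
  where "multilinear m A \<longleftrightarrow>
    (\<forall>xs i. length xs = m \<and> i < m \<longrightarrow> complex_linear (\<lambda>u. A (xs[i := u])))"

definition continuous_homogeneous_polynomial ::
    "nat \<Rightarrow> ('a::complex_banach \<Rightarrow> 'b::complex_banach) \<Rightarrow> bool"
  where "continuous_homogeneous_polynomial m P \<longleftrightarrow>
    (\<exists>A. multilinear m A \<and> P = (\<lambda>x. A (replicate m x))) \<and> continuous_on UNIV P"

definition continuous_polynomials :: "('a::complex_banach \<Rightarrow> 'b::complex_banach) set"
  where "continuous_polynomials =
    {P. \<exists>n Q. (\<forall>m. continuous_homogeneous_polynomial m (Q m)) \<and>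
          P = (\<lambda>x. \<Sum>m\<le>n. Q m x)}"

text \<open>Holomorphy means local uniform expandability in series of continuous homogeneous
  polynomials.\<close>

definition holomorphic_map ::
    "'a::complex_banach set \<Rightarrow> ('a \<Rightarrow> 'b::complex_banach) \<Rightarrow> bool"
  where "holomorphic_map U f \<longleftrightarrow>
    (\<forall>a\<in>U. \<exists>r>0. ball a r \<subseteq> U \<and>
      (\<exists>P. (\<forall>m. continuous_homogeneous_polynomial m (P m)) \<and>
        uniform_limit (ball a r) (\<lambda>n x. \<Sum>m<n. P m (x - a)) f sequentially))"

definition balanced :: "'a::complex_banach set \<Rightarrow> bool"
  where "balanced U \<longleftrightarrow> (\<forall>x\<in>U. \<forall>t. cmod t \<le> 1 \<longrightarrow> t *\<^sub>C x \<in> U)"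

definition U_bounded :: "'a::complex_banach set \<Rightarrow> 'a set \<Rightarrow> bool"
  where "U_bounded U A \<longleftrightarrow> A \<subseteq> U \<and> bounded A \<and>
    (\<exists>V. open V \<and> 0 \<in> V \<and> (\<forall>a\<in>A. \<forall>v\<in>V. a + v \<in> U))"

definition weight :: "'a::complex_banach set \<Rightarrow> ('a \<Rightarrow> real) \<Rightarrow> bool"
  where "weight U w \<longleftrightarrow> continuous_on U w \<and> (\<forall>x\<in>U. 0 < w x) \<and>
    (\<forall>A. U_bounded U A \<and> A \<noteq> {} \<longrightarrow> 0 < (INF x\<in>A. w x) \<and> bdd_above (w ` A))"

definition radial :: "'a::complex_banach set \<Rightarrow> ('a \<Rightarrow> real) \<Rightarrow> bool"
  where "radial U w \<longleftrightarrow> (\<forall>x\<in>U. \<forall>t. cmod t = 1 \<longrightarrow> w (t *\<^sub>C x) = w x)"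

text \<open>Maps \<open>U \<rightarrow> F\<close> are total functions in \<^term>\<open>extensional U\<close>.\<close>

definition Hw :: "'a::complex_banach set \<Rightarrow> ('a \<Rightarrow> real) \<Rightarrow> ('a \<Rightarrow> 'b::complex_banach) set"
  where "Hw U w = {f \<in> extensional U. holomorphic_map U f \<and>
    bdd_above ((\<lambda>x. w x * norm (f x)) ` U)}"

definition Hwc :: "'a::complex_banach set \<Rightarrow> ('a \<Rightarrow> real) \<Rightarrow> ('a \<Rightarrow> 'b::complex_banach) set"
  where "Hwc U w = {f \<in> Hw U w. relatively_compact ((\<lambda>x. w x *\<^sub>R f x) ` U)}"

text \<open>The suprema below are finite for \<open>f \<in> Hw U w\<close>, being bounded by
  the supremum of \<open>\<alpha>\<close> times the weighted norm of \<open>f\<close>.\<close>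

definition tauM_seminorm ::
    "('a \<Rightarrow> real) \<Rightarrow> (nat \<Rightarrow> real) \<Rightarrow> (nat \<Rightarrow> 'a set) \<Rightarrow>
      ('a::complex_banach \<Rightarrow> 'b::complex_banach) \<Rightarrow> real"
  where "tauM_seminorm w \<alpha> A f =
    (SUP j. \<alpha> j * (INF x\<in>A j. w x) * (SUP y\<in>A j. norm (f y)))"

definition tauM ::
    "'a::complex_banach set \<Rightarrow> ('a \<Rightarrow> real) \<Rightarrow> ('a \<Rightarrow> 'b::complex_banach) topology"
  where "tauM U w = topology_generated_by
    {{g \<in> Hw U w. tauM_seminorm w \<alpha> A (\<lambda>x. g x - f x) < \<epsilon>} | f \<alpha> A \<epsilon>.
      f \<in> Hw U w \<and> 0 < \<epsilon> \<and> (\<forall>j. 0 \<le> \<alpha> j) \<and> \<alpha> \<longlonglongrightarrow> 0 \<and>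
      (\<forall>j. finite (A j) \<and> A j \<noteq> {} \<and> A j \<subseteq> U)}"

end

theory Submission
  imports Defs "HOL-Complex_Analysis.Complex_Analysis"
begin

text \<open>
  Testing \<open>\<P>(E) \<subseteq> H\<^sub>w(U)\<close> on functionals shows that \<open>{w(x) x | x \<in> U}\<close> is weakly bounded, hence
  bounded. The condition defining a \<open>\<tau>\<^sub>M\<close>-neighbourhood of the inclusion therefore concerns, for a
  linear map, only the points \<open>\<alpha>\<^sub>j (inf w) y\<close> with \<open>y \<in> A\<^sub>j\<close>, which form a null sequence, and the
  compact approximation property supplies a compact operator inside the neighbourhood.

  Conversely, the derivative \<open>T\<close> at \<open>0\<close> of a map \<open>f\<close> in \<open>H\<^sub>w\<^sup>c\<close> is a compact operator, since \<open>T x\<close> is a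
  limit of averages of \<open>s\<^sup>-\<^sup>1 f(s x)\<close> over roots of unity \<open>s\<close>. Every point of a compact set is a sum of
  vectors \<open>v\<^sub>n\<close> from fixed finite sets \<open>B\<^sub>n\<close> with \<open>\<parallel>v\<^sub>n\<parallel> \<le> C 4\<^sup>-\<^sup>n\<close>, so it suffices that \<open>\<parallel>T v - v\<parallel>\<close> is at most
  a small multiple of \<open>2\<^sup>n \<parallel>v\<parallel>\<close> for \<open>v \<in> B\<^sub>n\<close>. By Cauchy's inequality this only needs \<open>f - I\<close> to be that
  small on the disc through a multiple of \<open>v\<close> of fixed norm, and the sup norm on a disc of a function
  bounded on a larger disc is controlled by finitely many sample points at a time, with weights tending
  to \<open>0\<close>, as the seminorms of \<open>\<tau>\<^sub>M\<close> require.
\<close>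

section \<open>Hahn--Banach and weak boundedness\<close>

definition sublinear :: "('a::real_vector \<Rightarrow> real) \<Rightarrow> bool"
  where "sublinear p \<longleftrightarrow>
    (\<forall>x y. p (x + y) \<le> p x + p y) \<and> (\<forall>c x. 0 \<le> c \<longrightarrow> p (c *\<^sub>R x) = c * p x)"

lemma sublinearD:
  assumes "sublinear p"
  shows "p (x + y) \<le> p x + p y" "0 \<le> c \<Longrightarrow> p (c *\<^sub>R x) = c * p x" "p 0 = 0" "- p (- x) \<le> p x"
proof -
  show add: "p (x + y) \<le> p x + p y" for x y
    using assms by (auto simp: sublinear_def)
  show hom: "0 \<le> c \<Longrightarrow> p (c *\<^sub>R x) = c * p x" for c x
    using assms by (auto simp: sublinear_def)
  show "p 0 = 0" using hom[of 0 0] by simp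
  then show "- p (- x) \<le> p x" using add[of x "- x"] by simp
qed

text \<open>An inequality for positive scalars suffices: applied to \<open>inverse c\<close> and
  \<open>c *\<^sub>R x\<close>, it yields the reverse inequality.\<close>

lemma sublinearI:
  assumes add: "\<And>x y. p (x + y) \<le> p x + p y" and 0: "p 0 = 0"
    and hom: "\<And>c x. 0 < c \<Longrightarrow> p (c *\<^sub>R x) \<le> c * p x"
  shows "sublinear p"
  unfolding sublinear_def
proof (intro conjI allI impI add)
  fix c :: real and x assume "0 \<le> c"
  show "p (c *\<^sub>R x) = c * p x"
  proof (cases "c = 0")
    case False
    with \<open>0 \<le> c\<close> have c: "0 < c" by simp
    have "p x \<le> inverse c * p (c *\<^sub>R x)"
      using hom[of "inverse c" "c *\<^sub>R x"] c by simp
    then have "c * p x \<le> p (c *\<^sub>R x)"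
      using c by (simp add: field_simps)
    with hom[OF c, of x] show ?thesis by simp
  qed (simp add: 0)
qed

text \<open>Applied to a minimal sublinear \<open>p\<close>, this forces \<open>p x + p z \<le> p (x + z)\<close>, so that \<open>p\<close> is linear.\<close>

lemma sublinear_below_shift:
  fixes p :: "'a::real_vector \<Rightarrow> real"
  assumes p: "sublinear p"
  obtains q where "sublinear q" "\<And>x. q x \<le> p x" "\<And>x. q x \<le> p (x + z) - p z"
proof -
  \<comment> \<open>The terms \<open>t = 0\<close> and \<open>t = 1\<close> give the two required
    upper bounds. The infimum is finite because subadditivity makes \<open>- p (- x)\<close> a lower
    bound.\<close>
  define q where "q = (\<lambda>x. INF t\<in>{0..}. p (x + t *\<^sub>R z) - t * p z)"
  have bdd: "bdd_below ((\<lambda>t. p (x + t *\<^sub>R z) - t * p z) ` {0..})" for x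
  proof (rule bdd_belowI2)
    fix t :: real assume "t \<in> {0..}"
    then show "- p (- x) \<le> p (x + t *\<^sub>R z) - t * p z"
      using sublinearD(1)[OF p, of "x + t *\<^sub>R z" "- x"] sublinearD(2)[OF p, of t z] by simp
  qed
  have low: "q x \<le> p (x + t *\<^sub>R z) - t * p z" if "0 \<le> t" for x t
    unfolding q_def using that by (intro cINF_lower bdd) auto
  have gr: "c \<le> q x" if "\<And>t. 0 \<le> t \<Longrightarrow> c \<le> p (x + t *\<^sub>R z) - t * p z" for c x
    unfolding q_def using that by (intro cINF_greatest) auto
  have "sublinear q"
  proof (rule sublinearI)
    fix x y
    have "q (x + y) \<le> (p (x + s *\<^sub>R z) - s * p z) + (p (y + t *\<^sub>R z) - t * p z)"
      if "0 \<le> s" "0 \<le> t" for s t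
      using low[of "s + t" "x + y"] that sublinearD(1)[OF p, of "x + s *\<^sub>R z" "y + t *\<^sub>R z"]
      by (simp add: algebra_simps)
    then have "q (x + y) - (p (x + s *\<^sub>R z) - s * p z) \<le> q y" if "0 \<le> s" for s
      using that by (intro gr) (metis diff_le_eq add.commute)
    then have "q (x + y) - q y \<le> q x"
      by (intro gr) (metis diff_le_eq add.commute)
    then show "q (x + y) \<le> q x + q y" by simp
  next
    have "0 \<le> q 0"
      by (rule gr) (simp add: sublinearD[OF p])
    with low[of 0 0] show "q 0 = 0" by (simp add: sublinearD[OF p])
  next
    fix c :: real and x assume c: "0 < c"
    have "q (c *\<^sub>R x) / c \<le> p (x + t *\<^sub>R z) - t * p z" if "0 \<le> t" for t
      using low[of "c * t" "c *\<^sub>R x"] that c sublinearD(2)[OF p, of c "x + t *\<^sub>R z"]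
      by (simp add: field_simps scaleR_add_right)
    then have "q (c *\<^sub>R x) / c \<le> q x" by (rule gr)
    then show "q (c *\<^sub>R x) \<le> c * q x" using c by (simp add: field_simps)
  qed
  moreover have "q x \<le> p x" "q x \<le> p (x + z) - p z" for x
    using low[of 0 x] low[of 1 x] by auto
  ultimately show ?thesis by (rule that)
qed

text \<open>Zorn's lemma for the reversed pointwise order. A nonempty chain is bounded below by its
  pointwise infimum, which is finite because \<open>q \<le> p\<close> forces
  \<open>- p (- x) \<le> q x\<close>. It is subadditive because, of two members of the chain, the
  smaller one can serve both arguments.\<close>

lemma sublinear_minimal:
  fixes p :: "'a::real_vector \<Rightarrow> real"
  assumes p: "sublinear p"
  obtains q where "sublinear q" "q \<le> p" "\<And>r. sublinear r \<Longrightarrow> r \<le> q \<Longrightarrow> r = q"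
proof -
  define A where "A = {q. sublinear q \<and> q \<le> p}"
  have "\<exists>m\<in>A. \<forall>a\<in>A. a \<le> m \<longrightarrow> a = m"
  proof (rule predicate_Zorn)
    show "partial_order_on A (relation_of (\<lambda>x y. y \<le> x) A)"
      by (rule partial_order_on_relation_ofI) auto
  next
    fix C assume C: "C \<in> Chains (relation_of (\<lambda>x y. y \<le> x) A)"
    then have CA: "C \<subseteq> A" and tot: "\<And>a b. a \<in> C \<Longrightarrow> b \<in> C \<Longrightarrow> a \<le> b \<or> b \<le> a"
      by (auto simp: Chains_def relation_of_def)
    show "\<exists>u\<in>A. \<forall>a\<in>C. u \<le> a"
    proof (cases "C = {}")
      case True
      then show ?thesis using p by (auto simp: A_def)
    next
      case False
      define u where "u = (\<lambda>x. INF q\<in>C. q x)"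
      have bdd: "bdd_below ((\<lambda>q. q x) ` C)" for x
      proof (rule bdd_belowI2)
        fix q assume "q \<in> C"
        then have "sublinear q" "q (- x) \<le> p (- x)" using CA by (auto simp: A_def le_fun_def)
        then show "- p (- x) \<le> q x" using sublinearD(4)[of q x] by simp
      qed
      have low: "u x \<le> q x" if "q \<in> C" for q x
        unfolding u_def using that by (intro cINF_lower bdd)
      have gr: "c \<le> u x" if "\<And>q. q \<in> C \<Longrightarrow> c \<le> q x" for c x
        unfolding u_def using that False by (intro cINF_greatest) auto
      have sub: "sublinear q" if "q \<in> C" for q
        using that CA by (auto simp: A_def)
      have "sublinear u"
      proof (rule sublinearI)
        fix x y
        have "u (x + y) \<le> q x + r y" if qr: "q \<in> C" "r \<in> C" for q r
        proof -
          obtain s where s: "s \<in> C" "s \<le> q" "s \<le> r" using tot[OF qr] qr by blast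
          have "u (x + y) \<le> s x + s y"
            using low[OF s(1), of "x + y"] sublinearD(1)[OF sub[OF s(1)], of x y] by simp
          then show ?thesis using s(2,3) by (smt (verit) le_funD)
        qed
        then have "u (x + y) - q x \<le> u y" if "q \<in> C" for q
          using that by (intro gr) (metis diff_le_eq add.commute)
        then have "u (x + y) - u y \<le> u x"
          by (intro gr) (metis diff_le_eq add.commute)
        then show "u (x + y) \<le> u x + u y" by simp
      next
        have "(\<lambda>q. q 0) ` C = {0}"
          using sublinearD(3)[OF sub] False by (auto simp: image_def)
        then show "u 0 = 0" by (simp add: u_def)
      next
        fix c :: real and x assume c: "0 < c"
        have "u (c *\<^sub>R x) / c \<le> q x" if "q \<in> C" for q
          using low[OF that, of "c *\<^sub>R x"] c sublinearD(2)[OF sub[OF that], of c x]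
          by (simp add: field_simps)
        then have "u (c *\<^sub>R x) / c \<le> u x" by (rule gr)
        then show "u (c *\<^sub>R x) \<le> c * u x" using c by (simp add: field_simps)
      qed
      moreover obtain q0 where "q0 \<in> C" using False by blast
      then have "u \<le> q0" "q0 \<le> p" using low CA by (auto simp: A_def le_fun_def)
      then have "u \<le> p" by (rule order_trans)
      ultimately show ?thesis using low by (auto simp: A_def le_fun_def)
    qed
  qed
  then obtain q where "q \<in> A" "\<And>a. a \<in> A \<Longrightarrow> a \<le> q \<Longrightarrow> a = q" by blast
  then show ?thesis
    using that[of q] by (force simp: A_def)
qed

text \<open>A minimal sublinear functional is linear, since shifting it by any \<open>z\<close>
  cannot lower it. Starting from the norm already shifted by \<open>y\<close> forces
  \<open>q (- y) \<le> - norm y\<close>, so that the functional attains the norm at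
  \<open>y\<close>.\<close>

lemma Hahn_Banach_norming:
  fixes y :: "'a::real_normed_vector"
  obtains u :: "'a \<Rightarrow>\<^sub>L real" where "norm u \<le> 1" "blinfun_apply u y = norm y"
proof -
  have "sublinear (norm :: 'a \<Rightarrow> real)"
    by (auto simp: sublinear_def norm_triangle_ineq)
  then obtain p where p: "sublinear p" "\<And>x. p x \<le> norm x" "\<And>x. p x \<le> norm (x + y) - norm y"
    by (rule sublinear_below_shift[where z = y]) blast
  obtain q where q: "sublinear q" "q \<le> p" and min: "\<And>r. sublinear r \<Longrightarrow> r \<le> q \<Longrightarrow> r = q"
    using sublinear_minimal[OF p(1)] by blast
  have qn: "q x \<le> norm x" for x using le_funD[OF q(2), of x] p(2)[of x] by linarith
  have add: "q (x + z) = q x + q z" for x z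
  proof (rule antisym)
    show "q (x + z) \<le> q x + q z" by (rule sublinearD(1)[OF q(1)])
    obtain r where r: "sublinear r" "\<And>x. r x \<le> q x" "\<And>x. r x \<le> q (x + z) - q z"
      by (rule sublinear_below_shift[OF q(1), of z]) blast
    then have "r = q" by (intro min) (auto simp: le_fun_def)
    with r(3)[of x] show "q x + q z \<le> q (x + z)" by simp
  qed
  have minus: "q (- x) = - q x" for x
    using add[of x "- x"] sublinearD(3)[OF q(1)] by simp
  have scale: "q (c *\<^sub>R x) = c * q x" for c x
  proof (cases "0 \<le> c")
    case False
    then have "q ((- c) *\<^sub>R x) = (- c) * q x" by (intro sublinearD(2)[OF q(1)]) auto
    then show ?thesis using minus[of "c *\<^sub>R x"] by simp
  qed (simp add: sublinearD(2)[OF q(1)])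
  have abs: "\<bar>q x\<bar> \<le> norm x" for x
    using qn[of x] qn[of "- x"] minus[of x] by simp
  have bl: "bounded_linear q"
    by (rule bounded_linear_intro[of _ 1]) (auto simp: add scale abs)
  have "q (- y) \<le> - norm y"
    using le_funD[OF q(2), of "- y"] p(3)[of "- y"] by simp
  then have "q y = norm y" using minus[of y] qn[of y] by simp
  moreover have "norm (Blinfun q) \<le> 1"
    by (rule norm_blinfun_bound) (auto simp: bounded_linear_Blinfun_apply[OF bl] abs)
  ultimately show ?thesis
    using that[of "Blinfun q"] by (simp add: bounded_linear_Blinfun_apply[OF bl])
qed

text \<open>Baire category in the dual, which is complete even if the space is not: the closed sets
  \<open>F n\<close> cover it, so one of them contains a ball, and norming functionals scaled into
  that ball bound \<open>Y\<close>.\<close>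

lemma weakly_bounded_imp_bounded:
  fixes Y :: "'a::real_normed_vector set"
  assumes wb: "\<And>u :: 'a \<Rightarrow>\<^sub>L real. bounded (blinfun_apply u ` Y)"
  shows "bounded Y"
proof -
  define F where "F = (\<lambda>n::nat. {u :: 'a \<Rightarrow>\<^sub>L real. \<forall>y\<in>Y. \<bar>blinfun_apply u y\<bar> \<le> real n})"
  have Feq: "F n = (\<Inter>y\<in>Y. {u. \<bar>blinfun_apply u y\<bar> \<le> real n})" for n
    by (auto simp: F_def)
  have cl: "closed (F n)" for n
    unfolding Feq by (intro closed_INT ballI closed_Collect_le continuous_intros)
  have un: "(\<Union>n. F n) = UNIV"
  proof safe
    fix u :: "'a \<Rightarrow>\<^sub>L real"
    obtain B where "\<And>y. y \<in> Y \<Longrightarrow> \<bar>blinfun_apply u y\<bar> \<le> B"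
      using wb[of u] by (auto simp: bounded_iff)
    moreover obtain n where "B \<le> real n" using real_arch_simple by blast
    ultimately have "u \<in> F n" by (force simp: F_def)
    then show "u \<in> (\<Union>n. F n)" by blast
  qed auto
  have "\<exists>n. interior (F n) \<noteq> {}"
  proof (rule ccontr)
    assume no: "\<nexists>n. interior (F n) \<noteq> {}"
    have "(euclidean :: ('a \<Rightarrow>\<^sub>L real) topology) interior_of \<Union>(range F) = {}"
    proof (rule Baire_category_alt)
      show "completely_metrizable_space (euclidean :: ('a \<Rightarrow>\<^sub>L real) topology) \<or>
        locally_compact_space (euclidean :: ('a \<Rightarrow>\<^sub>L real) topology) \<and>
        regular_space (euclidean :: ('a \<Rightarrow>\<^sub>L real) topology)"
        using completely_metrizable_space_euclidean by blast
      show "closedin euclidean T \<and> euclidean interior_of T = {}" if "T \<in> range F" for T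
        using that no cl by auto
    qed simp
    then show False using un by simp
  qed
  then obtain n u0 where "u0 \<in> interior (F n)" by blast
  then obtain e where e: "e > 0" "ball u0 e \<subseteq> F n" by (auto simp: mem_interior)
  have "norm y \<le> 4 * real n / e" if y: "y \<in> Y" for y
  proof -
    obtain u :: "'a \<Rightarrow>\<^sub>L real" where u: "norm u \<le> 1" "blinfun_apply u y = norm y"
      by (rule Hahn_Banach_norming)
    \<comment> \<open>Both \<open>u0\<close> and its translate by \<open>(e / 2) *\<^sub>R u\<close>
      lie in \<open>F n\<close>, so their difference is at most \<open>2 * real n\<close> on
      \<open>y\<close>.\<close>
    have "norm ((e / 2) *\<^sub>R u) \<le> e / 2" using e(1) u(1) by simp
    then have "u0 + (e / 2) *\<^sub>R u \<in> ball u0 e" using e(1) by (simp add: dist_norm)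
    then have "u0 + (e / 2) *\<^sub>R u \<in> F n" "u0 \<in> F n" using e by auto
    then have "\<bar>blinfun_apply (u0 + (e / 2) *\<^sub>R u) y\<bar> \<le> real n" "\<bar>blinfun_apply u0 y\<bar> \<le> real n"
      using y by (auto simp: F_def)
    then have "(e / 2) * norm y \<le> 2 * real n"
      by (simp add: blinfun.bilinear_simps u(2))
    then show ?thesis using e(1) by (simp add: field_simps)
  qed
  then show ?thesis by (auto simp: bounded_iff)
qed

section \<open>Complex scalars and functionals\<close>

lemma scaleC_one [simp]: "1 *\<^sub>C x = x"
  using scaleC_of_real[of 1 x] by simp

lemma scaleC_zero_right [simp]: "c *\<^sub>C 0 = 0"
  using norm_scaleC[of c "0::'a"] by simp

lemma scaleC_zero_left [simp]: "0 *\<^sub>C x = 0"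
  using scaleC_of_real[of 0 x] by simp

lemma scaleC_diff_left: "(c - d) *\<^sub>C x = c *\<^sub>C x - d *\<^sub>C x"
  using scaleC_add_left[of "c - d" d x] by (simp add: algebra_simps)

lemma scaleC_sum_left: "(\<Sum>i\<in>I. c i) *\<^sub>C x = (\<Sum>i\<in>I. c i *\<^sub>C x)"
  by (induction I rule: infinite_finite_induct) (auto simp: scaleC_add_left)

lemma bounded_bilinear_scaleC: "bounded_bilinear (\<lambda>c (x::'a::complex_banach). c *\<^sub>C x)"
proof (intro bounded_bilinear.intro exI[of _ 1])
  fix r :: real and c :: complex and x :: 'a
  show "(r *\<^sub>R c) *\<^sub>C x = r *\<^sub>R c *\<^sub>C x" "c *\<^sub>C r *\<^sub>R x = r *\<^sub>R c *\<^sub>C x"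
    by (simp_all add: scaleC_scaleC mult.commute scaleR_conv_of_real flip: scaleC_of_real)
qed (auto simp: scaleC_add_left scaleC_add_right norm_scaleC)

lemmas tendsto_scaleC = bounded_bilinear.tendsto[OF bounded_bilinear_scaleC]

lemma scaleC_scaleR_commute: "c *\<^sub>C r *\<^sub>R x = r *\<^sub>R c *\<^sub>C x"
  by (rule bounded_bilinear.scaleR_right[OF bounded_bilinear_scaleC])

lemma continuous_on_scaleC [continuous_intros]:
  assumes "continuous_on S f" "continuous_on S g"
  shows "continuous_on S (\<lambda>x. f x *\<^sub>C g x)"
  using assms unfolding continuous_on_def by (auto intro: tendsto_scaleC)

lemma complex_linearD:
  assumes "complex_linear T"
  shows "T (x + y) = T x + T y" "T (c *\<^sub>C x) = c *\<^sub>C T x" "T (r *\<^sub>R x) = r *\<^sub>R T x" "linear T"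
proof -
  show 1: "T (x + y) = T x + T y" "T (c *\<^sub>C x) = c *\<^sub>C T x" for x y c
    using assms by (auto simp: complex_linear_def)
  show 2: "T (r *\<^sub>R x) = r *\<^sub>R T x" for r x
    using 1(2)[of "complex_of_real r" x] by (simp add: scaleC_of_real)
  show "linear T" by (intro linearI 1 2)
qed

definition complex_functional :: "('a::complex_banach \<Rightarrow> complex) \<Rightarrow> bool"
  where "complex_functional \<phi> \<longleftrightarrow> complex_linear \<phi> \<and> bounded_linear \<phi>"

text \<open>The bound loses no factor: multiplying \<open>x\<close> by a unimodular scalar makes the
  value of \<open>\<phi>\<close> real, where it coincides with that of \<open>u\<close>.\<close>

lemma complexify_functional:
  fixes u :: "'a::complex_banach \<Rightarrow>\<^sub>L real"
  defines "\<phi> \<equiv> \<lambda>x. Complex (blinfun_apply u x) (- blinfun_apply u (\<i> *\<^sub>C x))"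
  shows "complex_functional \<phi>" "cmod (\<phi> x) \<le> norm u * norm x"
proof -
  have lin: "complex_linear \<phi>"
    unfolding complex_linear_def
  proof (intro conjI allI)
    fix x y c
    show "\<phi> (x + y) = \<phi> x + \<phi> y"
      by (simp add: \<phi>_def blinfun.bilinear_simps scaleC_add_right complex_eq_iff)
    define a b where "a = Re c" and "b = Im c"
    have c: "c = complex_of_real a + \<i> * complex_of_real b"
      by (simp add: a_def b_def complex_eq_iff)
    have cx: "c *\<^sub>C x = a *\<^sub>R x + b *\<^sub>R (\<i> *\<^sub>C x)" for x :: 'a
      unfolding c by (simp add: scaleC_add_left scaleC_of_real scaleC_scaleR_commute flip: scaleC_scaleC)
    have "\<i> *\<^sub>C c *\<^sub>C x = c *\<^sub>C \<i> *\<^sub>C x"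
      by (simp add: scaleC_scaleC mult.commute)
    also have "\<dots> = a *\<^sub>R (\<i> *\<^sub>C x) - b *\<^sub>R x"
      using cx[of "\<i> *\<^sub>C x"] scaleC_of_real[of "-1" x] by (simp add: scaleC_scaleC)
    finally show "\<phi> (c *\<^sub>C x) = c *\<^sub>C \<phi> x"
      unfolding \<phi>_def cx
      by (simp add: blinfun.bilinear_simps scaleC_complex_def complex_eq_iff a_def b_def)
  qed
  show le: "cmod (\<phi> x) \<le> norm u * norm x" for x
  proof (cases "\<phi> x = 0")
    case False
    define c where "c = cnj (sgn (\<phi> x))"
    have c: "cmod c = 1" using False by (simp add: c_def norm_sgn)
    have "\<phi> (c *\<^sub>C x) = c * \<phi> x"
      using complex_linearD(2)[OF lin] by (simp add: scaleC_complex_def)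
    also have "\<dots> = of_real (cmod (\<phi> x))"
    proof -
      have "cnj (\<phi> x) * \<phi> x = (of_real (cmod (\<phi> x)))\<^sup>2"
        by (metis complex_norm_square mult.commute of_real_power)
      then show ?thesis
        using False by (simp add: c_def sgn_eq power2_eq_square)
    qed
    finally have "cmod (\<phi> x) = Re (\<phi> (c *\<^sub>C x))" by simp
    also have "\<dots> = blinfun_apply u (c *\<^sub>C x)" by (simp add: \<phi>_def)
    also have "\<dots> \<le> norm u * norm (c *\<^sub>C x)" using norm_blinfun[of u "c *\<^sub>C x"] by simp
    finally show ?thesis using c by (simp add: norm_scaleC)
  qed simp
  have "bounded_linear \<phi>"
    by (rule bounded_linear_intro[of _ "norm u"])
       (use le in \<open>simp_all add: complex_linearD[OF lin] mult.commute\<close>)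
  with lin show "complex_functional \<phi>" by (simp add: complex_functional_def)
qed

text \<open>Reduces norm estimates for vector-valued functions to scalar ones. The real part of
  \<open>\<phi> y\<close> is already \<open>norm y\<close>.\<close>

lemma complex_Hahn_Banach_norming:
  fixes y :: "'a::complex_banach"
  obtains \<phi> where "complex_functional \<phi>" "\<And>x. cmod (\<phi> x) \<le> norm x" "norm y \<le> cmod (\<phi> y)"
proof -
  obtain u :: "'a \<Rightarrow>\<^sub>L real" where u: "norm u \<le> 1" "blinfun_apply u y = norm y"
    by (rule Hahn_Banach_norming)
  define \<phi> where "\<phi> = (\<lambda>x. Complex (blinfun_apply u x) (- blinfun_apply u (\<i> *\<^sub>C x)))"
  have "complex_functional \<phi>" "\<And>x. cmod (\<phi> x) \<le> norm u * norm x"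
    using complexify_functional[of u] by (simp_all add: \<phi>_def)
  moreover have "norm u * norm x \<le> norm x" for x
    using u(1) by (simp add: mult_left_le_one_le)
  moreover have "norm y \<le> cmod (\<phi> y)"
    using abs_Re_le_cmod[of "\<phi> y"] u(2) by (simp add: \<phi>_def)
  ultimately show ?thesis using that[of \<phi>] by (meson order_trans)
qed

section \<open>Compact sets in Banach spaces\<close>

lemma relatively_compactI:
  assumes "compact C" "S \<subseteq> C"
  shows "relatively_compact S"
  unfolding relatively_compact_def
  using assms by (metis closure_minimal compact_imp_closed compact_Int_closed closed_closure inf.absorb2)

lemma relatively_compact_subset:
  assumes "relatively_compact C" "S \<subseteq> C"
  shows "relatively_compact S"
  using assms closure_subset unfolding relatively_compact_def
  by (metis relatively_compactI relatively_compact_def subset_trans)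

lemma relatively_compact_closed_image:
  assumes "relatively_compact S" "continuous_on UNIV f"
  shows "relatively_compact (f ` S)"
proof (rule relatively_compactI)
  show "compact (f ` closure S)"
    using assms by (auto simp: relatively_compact_def intro: compact_continuous_image continuous_on_subset)
  show "f ` S \<subseteq> f ` closure S" using closure_subset by auto
qed

lemma compact_finite_net:
  fixes K :: "'a::metric_space set"
  assumes "compact K" "0 < e"
  obtains F where "finite F" "F \<subseteq> K" "K \<subseteq> (\<Union>x\<in>F. ball x e)"
proof -
  have "seq_compact K" using assms(1) by (simp add: compact_eq_seq_compact_metric)
  then show ?thesis using seq_compact_imp_totally_bounded[of K] assms(2) that by blast
qed

text \<open>Mazur's theorem. For a finite net \<open>F\<close> of \<open>C\<close>, the hull of
  \<open>C\<close> stays within \<open>e / 4\<close> of the hull of \<open>F\<close>, because a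
  Minkowski sum of convex sets is convex. The hull of \<open>F\<close> is compact and has a finite
  net \<open>G\<close>; the errors from \<open>G\<close>, from \<open>F\<close> and from the closure
  add up to less than \<open>e\<close>.\<close>

lemma compact_closure_convex_hull:
  fixes C :: "'a::banach set"
  assumes "compact C"
  shows "compact (closure (convex hull C))"
  unfolding compact_eq_totally_bounded
proof (intro conjI allI impI)
  show "complete (closure (convex hull C))" by (simp add: complete_eq_closed)
next
  fix e :: real assume e: "e > 0"
  obtain F where F: "finite F" "F \<subseteq> C" "C \<subseteq> (\<Union>x\<in>F. ball x (e / 4))"
    using compact_finite_net[OF assms, of "e / 4"] e by auto
  have "C \<subseteq> convex hull F + ball 0 (e / 4)"
  proof
    fix c assume "c \<in> C"
    then obtain x where x: "x \<in> F" "dist x c < e / 4" using F(3) by auto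
    then have "c = x + (c - x)" "x \<in> convex hull F" "c - x \<in> ball 0 (e / 4)"
      by (auto simp: dist_norm norm_minus_commute hull_inc)
    then show "c \<in> convex hull F + ball 0 (e / 4)" by (metis set_plus_intro)
  qed
  then have hull: "convex hull C \<subseteq> convex hull F + ball 0 (e / 4)"
    by (intro hull_minimal) (auto intro: convex_set_plus)
  have "compact (convex hull F)" using F(1) by (rule finite_imp_compact_convex_hull)
  then obtain G where G: "finite G" "convex hull F \<subseteq> (\<Union>x\<in>G. ball x (e / 4))"
    by (rule compact_finite_net[of _ "e / 4"]) (use e in auto)
  have "closure (convex hull C) \<subseteq> (\<Union>x\<in>G. ball x e)"
  proof
    fix z assume "z \<in> closure (convex hull C)"
    then obtain y where y: "y \<in> convex hull C" "dist y z < e / 4"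
      using e by (auto simp: closure_approachable dest: spec[of _ "e / 4"])
    then obtain a b where ab: "y = a + b" "a \<in> convex hull F" "norm b < e / 4"
    proof -
      have "y \<in> convex hull F + ball 0 (e / 4)" using y(1) hull by blast
      then show ?thesis using that by (auto elim!: set_plus_elim)
    qed
    then obtain x where x: "x \<in> G" "dist x a < e / 4" using G(2) by auto
    have "dist a y < e / 4" using ab by (simp add: dist_norm)
    then have "dist x z < e"
      using e x(2) y(2) dist_triangle[of x z a] dist_triangle[of a z y] by linarith
    then show "z \<in> (\<Union>x\<in>G. ball x e)" using x(1) by auto
  qed
  then show "\<exists>k. finite k \<and> closure (convex hull C) \<subseteq> (\<Union>x\<in>k. ball x e)" using G(1) by blast
qed

text \<open>Approximate a point by members of nets of mesh \<open>(1/4) ^ n\<close> and telescope: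
  the increments are differences of points from consecutive nets, and there are only finitely many
  of these at each level.\<close>

lemma compact_telescoping_nets:
  fixes K :: "'a::real_normed_vector set"
  assumes K: "compact K"
  obtains B :: "nat \<Rightarrow> 'a set" and C :: real
  where "\<And>n. finite (B n)" "0 < C" "\<And>n v. v \<in> B n \<Longrightarrow> norm v \<le> C * (1/4) ^ n"
    "\<And>x. x \<in> K \<Longrightarrow> \<exists>v. (\<forall>n. v n \<in> B n) \<and> v sums x"
proof -
  have "\<exists>F. finite F \<and> F \<subseteq> K \<and> K \<subseteq> (\<Union>x\<in>F. ball x ((1/4) ^ n))" for n
  proof -
    have "0 < (1/4 :: real) ^ n" by simp
    then obtain F where "finite F" "F \<subseteq> K" "K \<subseteq> (\<Union>x\<in>F. ball x ((1/4) ^ n))"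
      by (rule compact_finite_net[OF K])
    then show ?thesis by blast
  qed
  then obtain F where F: "\<And>n. finite (F n)" "\<And>n. F n \<subseteq> K"
    "\<And>n. K \<subseteq> (\<Union>x\<in>F n. ball x ((1/4) ^ n))" by metis
  obtain D where D: "\<And>x. x \<in> K \<Longrightarrow> norm x \<le> D"
    using compact_imp_bounded[OF K] by (auto simp: bounded_iff)
  \<comment> \<open>\<open>D\<close> bounds the first net; \<open>5\<close> comes from
    \<open>(1/4) ^ m + (1/4) ^ Suc m = 5 * (1/4) ^ Suc m\<close>, which bounds the distance of
    consecutive approximants.\<close>
  define C where "C = max D 5"
  \<comment> \<open>Most pairs from consecutive nets are far apart. Filtering by norm gives the size
    bound for free, and the increments that occur in telescoping pass the filter.\<close>
  define B where "B = (\<lambda>n. {v \<in> (case n of 0 \<Rightarrow> F 0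
    | Suc m \<Rightarrow> (\<lambda>(a, b). b - a) ` (F m \<times> F (Suc m))). norm v \<le> C * (1/4) ^ n})"
  show ?thesis
  proof (rule that)
    show "finite (B n)" for n by (auto simp: B_def F(1) split: nat.split)
    show "0 < C" by (simp add: C_def)
    show "norm v \<le> C * (1/4) ^ n" if "v \<in> B n" for n v using that by (simp add: B_def)
    fix x assume x: "x \<in> K"
    then have "\<exists>a. a \<in> F n \<and> dist a x < (1/4) ^ n" for n using F(3)[of n] by fastforce
    then obtain a where a: "\<And>n. a n \<in> F n" "\<And>n. dist (a n) x < (1/4) ^ n" by metis
    define v where "v = (\<lambda>n. case n of 0 \<Rightarrow> a 0 | Suc m \<Rightarrow> a (Suc m) - a m)"
    have "v n \<in> B n" for n
    proof (cases n)
      case 0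
      have "norm (a 0) \<le> C" using a(1)[of 0] F(2)[of 0] D[of "a 0"] by (auto simp: C_def)
      then show ?thesis using 0 a(1) by (simp add: B_def v_def)
    next
      case (Suc m)
      have "norm (a (Suc m) - a m) \<le> dist (a (Suc m)) x + dist (a m) x"
        by (metis dist_norm dist_triangle2)
      also have "\<dots> \<le> (1/4) ^ Suc m + (1/4) ^ m"
        using a(2)[of "Suc m"] a(2)[of m] by linarith
      also have "\<dots> = 5 * (1/4) ^ Suc m" by simp
      also have "\<dots> \<le> C * (1/4) ^ Suc m" by (intro mult_right_mono) (auto simp: C_def)
      finally have "norm (a (Suc m) - a m) \<le> C * (1/4) ^ Suc m" .
      moreover have "a (Suc m) - a m \<in> (\<lambda>(a, b). b - a) ` (F m \<times> F (Suc m))"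
        by (rule image_eqI[of _ _ "(a m, a (Suc m))"]) (simp_all add: a(1))
      ultimately show ?thesis unfolding B_def v_def Suc by simp
    qed
    moreover have "v sums x"
    proof -
      have "(\<lambda>n. (1/4::real) ^ n) \<longlonglongrightarrow> 0" by (rule LIMSEQ_power_zero) simp
      then have "(\<lambda>n. dist (a n) x) \<longlonglongrightarrow> 0"
        by (rule Lim_null_comparison[rotated]) (auto intro!: always_eventually less_imp_le[OF a(2)])
      then have lim: "a \<longlonglongrightarrow> x" by (rule tendsto_dist_iff[THEN iffD2])
      have "(\<Sum>i<Suc n. v i) = a n" for n
        by (induction n) (auto simp: v_def)
      then have "(\<lambda>n. \<Sum>i<Suc n. v i) \<longlonglongrightarrow> x" using lim by simp
      then show ?thesis unfolding sums_def by (rule filterlim_sequentially_Suc[THEN iffD1])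
    qed
    ultimately show "\<exists>v. (\<forall>n. v n \<in> B n) \<and> v sums x" by blast
  qed
qed

text \<open>The member of an open cover that contains \<open>0\<close> swallows all blocks from some
  index on, leaving finitely many points. Sets of this form carry the test points of a
  \<tau>-neighbourhood.\<close>

lemma compact_insert_null_blocks:
  fixes X :: "nat \<Rightarrow> 'a::real_normed_vector set"
  assumes fin: "\<And>n. finite (X n)" and b: "\<And>n x. x \<in> X n \<Longrightarrow> norm x \<le> b n" and "b \<longlonglongrightarrow> 0"
  shows "compact (insert 0 (\<Union>n. X n))"
proof (rule compactI)
  fix \<U> assume op: "\<forall>B\<in>\<U>. open B" and cov: "insert 0 (\<Union>n. X n) \<subseteq> \<Union>\<U>"
  then obtain B0 where B0: "B0 \<in> \<U>" "0 \<in> B0" by auto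
  then obtain e where e: "e > 0" "ball 0 e \<subseteq> B0" using op by (meson open_contains_ball)
  obtain N where N: "\<And>n. n \<ge> N \<Longrightarrow> b n < e"
    using order_tendstoD(2)[OF \<open>b \<longlonglongrightarrow> 0\<close> e(1)] by (auto simp: eventually_sequentially)
  have "\<forall>x\<in>(\<Union>n<N. X n). \<exists>B\<in>\<U>. x \<in> B" using cov by blast
  then obtain g where g: "\<And>x. x \<in> (\<Union>n<N. X n) \<Longrightarrow> g x \<in> \<U> \<and> x \<in> g x" by metis
  have "insert 0 (\<Union>n. X n) \<subseteq> \<Union>(insert B0 (g ` (\<Union>n<N. X n)))"
  proof
    fix x assume x: "x \<in> insert 0 (\<Union>n. X n)"
    show "x \<in> \<Union>(insert B0 (g ` (\<Union>n<N. X n)))"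
    proof (cases "x \<in> (\<Union>n<N. X n)")
      case False
      with x have "x \<in> ball 0 e"
      proof (cases "x = 0")
        case nz: False
        then obtain n where n: "x \<in> X n" using x by blast
        with False have "N \<le> n" by (auto simp: not_less[symmetric])
        then show ?thesis using b[OF n] N[of n] by simp
      qed (use e(1) in simp)
      then show ?thesis using e(2) by auto
    qed (use g in blast)
  qed
  moreover have "finite (insert B0 (g ` (\<Union>n<N. X n)))" using fin by auto
  ultimately show "\<exists>T'\<subseteq>\<U>. finite T' \<and> insert 0 (\<Union>n. X n) \<subseteq> \<Union>T'"
    using g B0 by (intro exI[of _ "insert B0 (g ` (\<Union>n<N. X n))"]) auto
qed

section \<open>Holomorphic maps\<close>

lemma homogeneous_polynomial_scaleC:
  assumes "continuous_homogeneous_polynomial m P"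
  shows "P (c *\<^sub>C x) = c ^ m *\<^sub>C P x"
proof -
  obtain A where A: "multilinear m A" "P = (\<lambda>x. A (replicate m x))"
    using assms by (auto simp: continuous_homogeneous_polynomial_def)
  \<comment> \<open>The scalar is extracted from one argument at a time, from the left;
    \<open>k\<close> counts the arguments already treated.\<close>
  have "A (replicate k (c *\<^sub>C x) @ replicate (m - k) x) = c ^ k *\<^sub>C A (replicate m x)"
    if "k \<le> m" for k
    using that
  proof (induction k)
    case (Suc k)
    define xs where "xs = replicate k (c *\<^sub>C x) @ x # replicate (m - Suc k) x"
    have lin: "complex_linear (\<lambda>u. A (xs[k := u]))"
      using A(1) Suc.prems by (auto simp: multilinear_def xs_def)
    have "replicate (Suc k) (c *\<^sub>C x) @ replicate (m - Suc k) x = xs[k := c *\<^sub>C x]"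
      by (simp add: xs_def list_update_append replicate_app_Cons_same)
    then have "A (replicate (Suc k) (c *\<^sub>C x) @ replicate (m - Suc k) x) = c *\<^sub>C A (xs[k := x])"
      using complex_linearD(2)[OF lin, of c x] by simp
    also have "xs[k := x] = replicate k (c *\<^sub>C x) @ replicate (m - k) x"
    proof -
      have "m - k = Suc (m - Suc k)" using Suc.prems by simp
      then show ?thesis by (simp add: xs_def list_update_append)
    qed
    finally show ?case using Suc by (simp add: scaleC_scaleC)
  qed simp
  from this[of m] show ?thesis by (simp add: A(2))
qed

lemma homogeneous_polynomial_1_linear:
  assumes "continuous_homogeneous_polynomial 1 P"
  shows "complex_linear P"
proof -
  obtain A where A: "multilinear 1 A" "P = (\<lambda>x. A (replicate 1 x))"
    using assms unfolding continuous_homogeneous_polynomial_def by blast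
  \<comment> \<open>The list \<open>[0]\<close> is only a template of length 1 whose single entry is
    overwritten.\<close>
  have "complex_linear (\<lambda>u. A ([0][0 := u]))"
    using A(1) unfolding multilinear_def by (metis One_nat_def length_Cons less_one list.size(3))
  then show ?thesis by (simp add: A(2))
qed

lemma homogeneous_polynomial_const: "continuous_homogeneous_polynomial 0 (\<lambda>x. c)"
  unfolding continuous_homogeneous_polynomial_def
  by (intro conjI exI[of _ "\<lambda>_. c"]) (auto simp: multilinear_def)

lemma homogeneous_polynomial_zero: "continuous_homogeneous_polynomial m (\<lambda>x. 0)"
  unfolding continuous_homogeneous_polynomial_def
  by (intro conjI exI[of _ "\<lambda>_. 0"]) (auto simp: multilinear_def complex_linear_def)

lemma homogeneous_polynomial_linear:
  assumes "complex_linear T" "bounded_linear T"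
  shows "continuous_homogeneous_polynomial 1 T"
  unfolding continuous_homogeneous_polynomial_def
proof (intro conjI exI[of _ "\<lambda>xs. T (hd xs)"])
  show "multilinear 1 (\<lambda>xs. T (hd xs))"
    using assms(1) by (auto simp: multilinear_def length_Suc_conv)
  show "continuous_on UNIV T"
    using assms(2) by (simp add: linear_continuous_on)
qed auto

lemma functional_in_continuous_polynomials:
  assumes "complex_functional \<phi>"
  shows "\<phi> \<in> continuous_polynomials"
proof -
  have "continuous_homogeneous_polynomial m (if m = 1 then \<phi> else (\<lambda>x. 0))" for m
    using assms by (auto simp: complex_functional_def homogeneous_polynomial_zero
        intro: homogeneous_polynomial_linear[simplified])
  moreover have "\<phi> = (\<lambda>x. \<Sum>m\<le>1. (if m = (1::nat) then \<phi> else (\<lambda>x. 0)) x)"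
    by (auto simp: fun_eq_iff)
  ultimately show ?thesis unfolding continuous_polynomials_def
    by (intro CollectI exI[of _ 1] exI[of _ "\<lambda>m. if m = 1 then \<phi> else (\<lambda>x. 0)"]) auto
qed

lemma bounded_linear_holomorphic_map:
  assumes "complex_linear T" "bounded_linear T" "open U" and f: "\<And>x. x \<in> U \<Longrightarrow> f x = T x"
  shows "holomorphic_map U f"
  unfolding holomorphic_map_def
proof
  fix a assume "a \<in> U"
  then obtain r where r: "r > 0" "ball a r \<subseteq> U" using \<open>open U\<close> by (meson open_contains_ball)
  \<comment> \<open>The expansion at \<open>a\<close> is \<open>T x = T a + T (x - a)\<close>, so
    partial sums are exact as soon as they have two terms.\<close>
  define P where "P = (\<lambda>m::nat. if m = 0 then (\<lambda>x. T a) else if m = 1 then T else (\<lambda>x. 0))"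
  have P: "continuous_homogeneous_polynomial m (P m)" for m
    using homogeneous_polynomial_linear[OF assms(1,2)] homogeneous_polynomial_const[of "T a"]
      homogeneous_polynomial_zero[of m] by (auto simp: P_def)
  have Psum: "(\<Sum>m<n. P m (x - a)) = f x" if "n \<ge> 2" "x \<in> ball a r" for n x
  proof -
    have "(\<Sum>m<n. P m (x - a)) = (\<Sum>m\<in>{0, 1}. P m (x - a))"
      using that(1) by (intro sum.mono_neutral_right) (auto simp: P_def)
    also have "\<dots> = T a + T (x - a)" by (simp add: P_def)
    also have "\<dots> = T x" using complex_linearD(1)[OF assms(1), of a "x - a"] by simp
    finally show ?thesis using f that(2) r(2) by auto
  qed
  have "uniform_limit (ball a r) (\<lambda>n x. \<Sum>m<n. P m (x - a)) f sequentially"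
  proof (rule uniform_limitI)
    fix e :: real assume "e > 0"
    then show "\<forall>\<^sub>F n in sequentially. \<forall>x\<in>ball a r. dist (\<Sum>m<n. P m (x - a)) (f x) < e"
      using Psum by (auto simp: eventually_sequentially intro!: exI[of _ 2])
  qed
  then show "\<exists>r>0. ball a r \<subseteq> U \<and> (\<exists>P. (\<forall>m. continuous_homogeneous_polynomial m (P m)) \<and>
      uniform_limit (ball a r) (\<lambda>n x. \<Sum>m<n. P m (x - a)) f sequentially)"
    using P r by blast
qed

text \<open>On a complex line the homogeneous polynomials become monomials: the partial sums
  composed with \<open>\<phi>\<close> are polynomials in \<open>t - z\<close>, and Weierstrass'
  theorem on uniform limits applies.\<close>

lemma holomorphic_map_along_line:
  fixes f :: "'a::complex_banach \<Rightarrow> 'b::complex_banach"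
  assumes f: "holomorphic_map U f" and \<phi>: "complex_functional \<phi>"
    and S: "open S" "\<And>t. t \<in> S \<Longrightarrow> t *\<^sub>C v \<in> U"
  shows "(\<lambda>t. \<phi> (f (t *\<^sub>C v))) holomorphic_on S"
proof (subst holomorphic_on_open[OF S(1)], intro ballI)
  have bl: "bounded_linear \<phi>" and cl: "complex_linear \<phi>"
    using \<phi> by (auto simp: complex_functional_def)
  fix z assume "z \<in> S"
  then have "z *\<^sub>C v \<in> U" using S by auto
  then obtain r P where r: "r > 0" and P: "\<And>m. continuous_homogeneous_polynomial m (P m)"
    and lim: "uniform_limit (ball (z *\<^sub>C v) r) (\<lambda>n x. \<Sum>m<n. P m (x - z *\<^sub>C v)) f sequentially"
    using f unfolding holomorphic_map_def by meson
  \<comment> \<open>The added 1 covers the case \<open>v = 0\<close>.\<close>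
  define d where "d = r / (norm v + 1)"
  have d: "d > 0" using r by (simp add: d_def add_nonneg_pos)
  have in_ball: "t *\<^sub>C v \<in> ball (z *\<^sub>C v) r" if "t \<in> ball z d" for t
  proof -
    have "dist (z *\<^sub>C v) (t *\<^sub>C v) = cmod (z - t) * norm v"
      by (simp add: dist_norm norm_scaleC flip: scaleC_diff_left)
    also have "\<dots> \<le> cmod (z - t) * (norm v + 1)" by (intro mult_left_mono) auto
    also have "\<dots> < d * (norm v + 1)"
      using that by (intro mult_strict_right_mono) (auto simp: dist_norm add_nonneg_pos)
    also have "\<dots> = r" by (simp add: d_def add_nonneg_eq_0_iff)
    finally show ?thesis by simp
  qed
  define g where "g = (\<lambda>n t. \<Sum>m<n. (t - z) ^ m * \<phi> (P m v))"
  have g: "\<phi> (\<Sum>m<n. P m (t *\<^sub>C v - z *\<^sub>C v)) = g n t" for n t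
    by (simp add: g_def linear_sum[OF complex_linearD(4)[OF cl]] complex_linearD(2)[OF cl]
        homogeneous_polynomial_scaleC[OF P] scaleC_complex_def flip: scaleC_diff_left)
  have "uniform_limit (ball z d) (\<lambda>n t. \<Sum>m<n. P m (t *\<^sub>C v - z *\<^sub>C v)) (\<lambda>t. f (t *\<^sub>C v)) sequentially"
    by (rule uniform_limit_compose'[OF lim]) (use in_ball in auto)
  then have "uniform_limit (ball z d) (\<lambda>n t. \<phi> (\<Sum>m<n. P m (t *\<^sub>C v - z *\<^sub>C v))) (\<lambda>t. \<phi> (f (t *\<^sub>C v))) sequentially"
    by (rule bounded_linear.uniform_limit[OF bl])
  then have ug: "uniform_limit (ball z d) g (\<lambda>t. \<phi> (f (t *\<^sub>C v))) sequentially"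
    by (simp add: g)
  have "(\<lambda>t. \<phi> (f (t *\<^sub>C v))) holomorphic_on ball z d"
  proof (rule holomorphic_uniform_sequence)
    show "open (ball z d)" by simp
    show "g n holomorphic_on ball z d" for n
      unfolding g_def by (intro holomorphic_intros)
    fix x assume "x \<in> ball z d"
    then obtain e where "e > 0" "cball x e \<subseteq> ball z d"
      by (meson open_ball open_contains_cball)
    then show "\<exists>d'>0. cball x d' \<subseteq> ball z d \<and> uniform_limit (cball x d') g (\<lambda>t. \<phi> (f (t *\<^sub>C v))) sequentially"
      using uniform_limit_on_subset[OF ug] by blast
  qed
  then show "\<exists>f'. ((\<lambda>t. \<phi> (f (t *\<^sub>C v))) has_field_derivative f') (at z)"
    using d by (subst (asm) holomorphic_on_open) auto
qed

text \<open>Along a line through 0 the expansion is a power series with coefficients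
  \<open>\<phi> (P m v)\<close>. Its derivative at 0 describes the linear term in a form to which
  Cauchy's inequality applies.\<close>

lemma deriv_along_line:
  assumes P: "\<And>m. continuous_homogeneous_polynomial m (P m)"
    and lim: "\<And>x. x \<in> ball 0 r \<Longrightarrow> (\<lambda>m. P m x) sums f x" and r: "r > 0"
    and \<phi>: "complex_functional \<phi>"
  shows "((\<lambda>t. \<phi> (f (t *\<^sub>C v))) has_field_derivative \<phi> (P 1 v)) (at 0)"
proof -
  have bl: "bounded_linear \<phi>" and cl: "complex_linear \<phi>"
    using \<phi> by (auto simp: complex_functional_def)
  define d where "d = r / (norm v + 1)"
  have d: "d > 0" using r by (simp add: d_def add_nonneg_pos)
  define c where "c = (\<lambda>m. \<phi> (P m v))"
  have s: "(\<lambda>m. c m * t ^ m) sums \<phi> (f (t *\<^sub>C v))" if "t \<in> ball 0 d" for t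
  proof -
    have "norm (t *\<^sub>C v) \<le> cmod t * (norm v + 1)"
      by (simp add: norm_scaleC mult_left_mono)
    also have "\<dots> < d * (norm v + 1)"
      using that by (intro mult_strict_right_mono) (auto simp: add_nonneg_pos)
    also have "\<dots> = r" by (simp add: d_def add_nonneg_eq_0_iff)
    finally have "(\<lambda>m. \<phi> (P m (t *\<^sub>C v))) sums \<phi> (f (t *\<^sub>C v))"
      by (intro bounded_linear.sums[OF bl] lim) simp
    then show ?thesis
      by (simp add: homogeneous_polynomial_scaleC[OF P] complex_linearD(2)[OF cl] c_def
          scaleC_complex_def mult.commute)
  qed
  \<comment> \<open>Convergence at one nonzero point allows termwise differentiation at 0.\<close>
  have "summable (\<lambda>m. c m * (of_real (d / 2)) ^ m)"
    using s[of "of_real (d / 2)"] d by (auto simp: summable_def)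
  then have "((\<lambda>t. \<Sum>m. c m * t ^ m) has_field_derivative (\<Sum>m. diffs c m * 0 ^ m)) (at 0)"
    by (rule termdiffs_strong) (use d in auto)
  moreover have "(\<Sum>m. diffs c m * 0 ^ m) = c 1"
    by (simp add: diffs_def)
  ultimately have "((\<lambda>t. \<Sum>m. c m * t ^ m) has_field_derivative c 1) (at 0)" by simp
  then have "((\<lambda>t. \<phi> (f (t *\<^sub>C v))) has_field_derivative c 1) (at 0)"
    by (rule has_field_derivative_transform_within_open[where S = "ball 0 d"])
       (use d s in \<open>auto simp: sums_unique[symmetric]\<close>)
  then show ?thesis by (simp add: c_def)
qed

section \<open>Cauchy estimates and sampling on discs\<close>

text \<open>Each point of the inner disc has a disc of radius \<open>R - r\<close> around it inside
  the outer one, so Cauchy's inequality bounds the derivative there; convexity turns this into a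
  Lipschitz bound.\<close>

lemma holomorphic_Lipschitz_inner_disc:
  assumes h: "h holomorphic_on S" "open S" "cball 0 R \<subseteq> S" and "r < R"
    and M: "\<And>z. z \<in> cball 0 R \<Longrightarrow> cmod (h z) \<le> M" and st: "s \<in> cball 0 r" "t \<in> cball 0 r"
  shows "cmod (h s - h t) \<le> M / (R - r) * cmod (s - t)"
proof (rule field_differentiable_bound[OF convex_cball _ _ st])
  fix z :: complex assume z: "z \<in> cball 0 r"
  have sub: "cball z (R - r) \<subseteq> cball 0 R"
    using z by (simp add: cball_subset_cball_iff dist_norm)
  have "z \<in> S" using z h(3) \<open>r < R\<close> by (auto simp: subset_iff)
  then show "(h has_field_derivative deriv h z) (at z within cball 0 r)"
    using h(1,2) by (meson holomorphic_derivI has_field_derivative_at_within)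
  have "norm ((deriv ^^ 1) h z) \<le> fact 1 * M / (R - r) ^ 1"
  proof (rule Cauchy_inequality)
    show "h holomorphic_on ball z (R - r)"
      using sub h(3) by (intro holomorphic_on_subset[OF h(1)]) (auto simp: subset_iff)
    show "continuous_on (cball z (R - r)) h"
      using sub h by (intro holomorphic_on_imp_continuous_on holomorphic_on_subset[OF h(1)]) auto
    show "cmod (h x) \<le> M" if "cmod (z - x) = R - r" for x
      using that sub by (intro M) (auto simp: dist_norm subset_iff)
  qed (use \<open>r < R\<close> in simp)
  then show "cmod (deriv h z) \<le> M / (R - r)" by simp
qed

text \<open>With \<open>r\<^sub>k = 2 - 2\<^sup>-\<^sup>k\<close> and \<open>M\<^sub>k\<close> the maximum of \<open>\<parallel>G\<parallel>\<close> on the disc of radius \<open>r\<^sub>k\<close>, a sufficiently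
  fine net \<open>T\<^sub>k\<close> of that disc gives \<open>M\<^sub>k \<le> max\<^sub>T \<parallel>G\<parallel> + M\<^sub>k\<^sub>+\<^sub>1 / 4\<close>. Iterating this removes the unknown bound
  of \<open>G\<close> on the whole disc, even though the samples may grow like \<open>2\<^sup>k\<close>.\<close>

lemma sampling_nets:
  obtains T :: "nat \<Rightarrow> complex set"
  where "\<And>n. finite (T n)" "\<And>n. T n \<subseteq> cball 0 2"
    "\<And>(G :: complex \<Rightarrow> 'b::complex_banach) S n P t.
      \<lbrakk>open S; cball 0 2 \<subseteq> S; \<And>\<phi>. complex_functional \<phi> \<Longrightarrow> (\<lambda>t. \<phi> (G t)) holomorphic_on S;
        bounded (G ` cball 0 2); \<And>k t. n \<le> k \<Longrightarrow> t \<in> T k \<Longrightarrow> norm (G t) \<le> 2 ^ k * P; 0 \<le> P;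
        t \<in> cball 0 1\<rbrakk> \<Longrightarrow> norm (G t) \<le> 2 * 2 ^ n * P"
proof -
  define r where "r = (\<lambda>n. 2 - (1/2::real) ^ n)"
  \<comment> \<open>The mesh is a quarter of the gap \<open>r (Suc n) - r n\<close>, so the
    Lipschitz bound \<open>M / gap\<close> costs at most \<open>M / 4\<close>.\<close>
  define \<delta> where "\<delta> = (\<lambda>n. (1/2::real) ^ Suc n / 4)"
  have r: "r n < r (Suc n)" "r n \<le> 2" "1 \<le> r n" "r (Suc n) - r n = (1/2) ^ Suc n" for n
    by (auto simp: r_def power_le_one)
  have "\<exists>F. finite F \<and> F \<subseteq> cball 0 (r n) \<and> cball (0::complex) (r n) \<subseteq> (\<Union>x\<in>F. ball x (\<delta> n))" for n
  proof -
    have "0 < \<delta> n" by (simp add: \<delta>_def)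
    then obtain F where "finite F" "F \<subseteq> cball 0 (r n)" "cball (0::complex) (r n) \<subseteq> (\<Union>x\<in>F. ball x (\<delta> n))"
      by (rule compact_finite_net[OF compact_cball])
    then show ?thesis by blast
  qed
  then obtain T where T: "\<And>n. finite (T n)" "\<And>n. T n \<subseteq> cball 0 (r n)"
    "\<And>n. cball (0::complex) (r n) \<subseteq> (\<Union>x\<in>T n. ball x (\<delta> n))" by metis
  show ?thesis
  proof (rule that[of T])
    show "finite (T n)" for n by (rule T)
    show "T n \<subseteq> cball 0 2" for n using T(2)[of n] r(2)[of n] by (auto simp: subset_iff)
    fix G :: "complex \<Rightarrow> 'b" and S n P and t :: complex
    assume S: "open S" "cball 0 2 \<subseteq> S"
      and hol: "\<And>\<phi>. complex_functional \<phi> \<Longrightarrow> (\<lambda>t. \<phi> (G t)) holomorphic_on S"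
      and bdd: "bounded (G ` cball 0 2)"
      and samp: "\<And>k t. n \<le> k \<Longrightarrow> t \<in> T k \<Longrightarrow> norm (G t) \<le> 2 ^ k * P" and P: "0 \<le> P"
      and t: "t \<in> cball 0 1"
    obtain B where B: "\<And>t. t \<in> cball 0 2 \<Longrightarrow> norm (G t) \<le> B"
    proof -
      have "\<exists>B. \<forall>t\<in>cball 0 2. norm (G t) \<le> B" using bdd unfolding bounded_iff by blast
      then show ?thesis using that by blast
    qed
    have step: "norm (G t) \<le> 2 ^ k * P + M / 4"
      if "n \<le> k" and t: "t \<in> cball 0 (r k)" and M: "\<And>z. z \<in> cball 0 (r (Suc k)) \<Longrightarrow> norm (G z) \<le> M"
      for k t M
    proof -
      obtain s where s: "s \<in> T k" "dist s t < \<delta> k" using T(3)[of k] t by auto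
      then have s': "s \<in> cball 0 (r k)" using T(2) by blast
      have "0 \<le> M" using M[of 0] r(3)[of "Suc k"] by (auto intro: order_trans[OF norm_ge_zero])
      obtain \<phi> where \<phi>: "complex_functional \<phi>" "\<And>x. cmod (\<phi> x) \<le> norm x"
          "norm (G t - G s) \<le> cmod (\<phi> (G t - G s))"
        by (rule complex_Hahn_Banach_norming[of "G t - G s"]) blast
      have lin: "linear \<phi>" using \<phi>(1) by (auto simp: complex_functional_def dest: complex_linearD(4))
      have "norm (G t - G s) \<le> cmod (\<phi> (G t) - \<phi> (G s))" using \<phi>(3) by (simp add: linear_diff[OF lin])
      also have "\<dots> \<le> M / (r (Suc k) - r k) * cmod (t - s)"
      proof (rule holomorphic_Lipschitz_inner_disc[OF hol[OF \<phi>(1)] S(1)])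
        show "cball 0 (r (Suc k)) \<subseteq> S" using S(2) r(2)[of "Suc k"] by (auto simp: subset_iff)
        show "cmod (\<phi> (G z)) \<le> M" if "z \<in> cball 0 (r (Suc k))" for z
          using \<phi>(2)[of "G z"] M[OF that] by simp
      qed (use r s' t in auto)
      also have "\<dots> \<le> M / (r (Suc k) - r k) * \<delta> k"
        using s(2) \<open>0 \<le> M\<close> r(1)[of k] by (intro mult_left_mono) (auto simp: dist_norm norm_minus_commute)
      also have "\<dots> = M / 4" by (simp add: r(4) \<delta>_def)
      finally show ?thesis
        using samp[OF that(1) s(1)] norm_triangle_sub[of "G t" "G s"] by simp
    qed
    \<comment> \<open>The constant 2 reproduces itself:
      \<open>2 ^ k * P + (2 * 2 ^ Suc k * P) / 4 = 2 * 2 ^ k * P\<close>, while the crude bound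
      \<open>B\<close> gains a factor 1/4 in each round.\<close>
    have it: "n \<le> k \<Longrightarrow> t \<in> cball 0 (r k) \<Longrightarrow> norm (G t) \<le> 2 * 2 ^ k * P + (1/4) ^ j * B" for j k t
    proof (induction j arbitrary: k t)
      case 0
      then have "norm (G t) \<le> B" using B r(2)[of k] by auto
      then show ?case using P by (simp add: add_increasing)
    next
      case (Suc j)
      have "norm (G t) \<le> 2 ^ k * P + (2 * 2 ^ Suc k * P + (1/4) ^ j * B) / 4"
        by (rule step) (use Suc.prems Suc.IH[of "Suc k"] in simp_all)
      then show ?case by (simp add: field_simps)
    qed
    have "(\<lambda>j. 2 * 2 ^ n * P + (1/4) ^ j * B) \<longlonglongrightarrow> 2 * 2 ^ n * P + 0 * B"
      by (intro tendsto_intros LIMSEQ_power_zero) auto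
    moreover have "t \<in> cball 0 (r n)" using t r(3)[of n] by auto
    ultimately show "norm (G t) \<le> 2 * 2 ^ n * P"
      using it[of n t] by (intro LIMSEQ_le_const) auto
  qed
qed

section \<open>Averages over roots of unity\<close>

text \<open>This is a geometric sum in \<open>z\<close>, the \<open>j\<close>-th power of a
  primitive root: \<open>z ^ N = 1\<close>, and \<open>z = 1\<close> exactly when
  \<open>N dvd j\<close>.\<close>

lemma average_root_of_unity_powers:
  fixes j N :: nat
  assumes "N \<ge> 1"
  shows "(\<Sum>k<N. cis (2 * pi / N) ^ (k * j)) = (if N dvd j then of_nat N else 0)"
proof -
  define z where "z = cis (2 * pi / N) ^ j"
  have z: "z = exp (2 * of_real pi * \<i> * of_nat j / of_nat N)"
    by (simp add: z_def cis_conv_exp mult_ac flip: exp_of_nat_mult)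
  have eq: "(\<Sum>k<N. cis (2 * pi / N) ^ (k * j)) = (\<Sum>k<N. z ^ k)"
    by (simp add: z_def mult.commute flip: power_mult)
  show ?thesis
  proof (cases "N dvd j")
    case True
    then have "z = 1" using complex_root_unity_eq_1[OF assms, of j] z by simp
    then show ?thesis using True eq by simp
  next
    case False
    then have z1: "z \<noteq> 1" using complex_root_unity_eq_1[OF assms, of j] z by simp
    have "real N * (2 * pi / real N) = 2 * pi" using assms by simp
    then have "cis (2 * pi / N) ^ N = 1" by (simp only: Complex.DeMoivre cis_2pi)
    then have "z ^ N = 1" unfolding z_def by (metis mult.commute power_mult power_one)
    then show ?thesis using False eq geometric_sum[OF z1] by simp
  qed
qed

text \<open>Averaging \<open>s\<^sup>-\<^sup>1 f(s x)\<close> over the \<open>N\<close>-th roots of unity \<open>s\<close> leaves the terms of degree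
  \<open>1, N + 1, 2 N + 1, \<dots>\<close>, and hence tends to \<open>P 1 x\<close>.\<close>

lemma linear_coefficient_in_closed_convex:
  assumes P: "\<And>m. continuous_homogeneous_polynomial m (P m)"
    and lim: "\<And>y. y \<in> ball 0 r \<Longrightarrow> (\<lambda>m. P m y) sums f y"
    and C: "closed C" "convex C" "\<And>s y. cmod s = 1 \<Longrightarrow> y \<in> ball 0 r \<Longrightarrow> s *\<^sub>C f y \<in> C"
    and x: "2 *\<^sub>R x \<in> ball 0 r"
  shows "P 1 x \<in> C"
proof -
  have x': "x \<in> ball 0 r" using x by (auto intro: le_less_trans[rotated])
  \<comment> \<open>Boundedness of the terms at twice the point gives geometric decay at
    \<open>x\<close> by homogeneity.\<close>
  have "(\<lambda>m. P m (2 *\<^sub>R x)) \<longlonglongrightarrow> 0"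
    using lim[OF x] by (intro summable_LIMSEQ_zero sums_summable)
  then have "Bseq (\<lambda>m. P m (2 *\<^sub>R x))" by (intro convergent_imp_Bseq convergentI)
  then obtain M where M: "M > 0" "\<And>m. norm (P m (2 *\<^sub>R x)) \<le> M" by (auto simp: Bseq_def)
  have Pm: "norm (P m x) \<le> M * (1/2) ^ m" for m
  proof -
    have "P m (2 *\<^sub>R x) = of_real (2 ^ m) *\<^sub>C P m x"
      using homogeneous_polynomial_scaleC[OF P, of m "of_real 2" x] scaleC_of_real[of 2 x] by simp
    then have "norm (P m (2 *\<^sub>R x)) = 2 ^ m * norm (P m x)" by (simp add: norm_scaleC norm_power)
    then show ?thesis using M(2)[of m] by (simp add: field_simps)
  qed
  define \<omega> where "\<omega> = (\<lambda>N::nat. cis (2 * pi / N))"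
  \<comment> \<open>The exponent \<open>k * (N - 1)\<close> represents the inverse of
    \<open>\<omega> N ^ k\<close> without negative powers. The factor is unimodular, so
    \<open>A N\<close> is a convex combination of points of \<open>C\<close>.\<close>
  define A where "A = (\<lambda>N. \<Sum>k<N. (1 / real N) *\<^sub>R (\<omega> N ^ (k * (N - 1)) *\<^sub>C f (\<omega> N ^ k *\<^sub>C x)))"
  have nrm: "cmod (\<omega> N ^ k) = 1" for N k by (simp add: \<omega>_def norm_power)
  have inC: "A N \<in> C" if "N \<ge> 2" for N
    unfolding A_def
  proof (rule convex_sum[OF _ C(2)])
    show "(\<Sum>k<N. 1 / real N) = 1" using that by simp
    show "\<omega> N ^ (k * (N - 1)) *\<^sub>C f (\<omega> N ^ k *\<^sub>C x) \<in> C" for k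
      using x' by (intro C(3) nrm) (simp add: norm_scaleC nrm)
  qed auto
  have bound: "norm (A N - P 1 x) \<le> 2 * M * (1/2) ^ N" if N: "N \<ge> 2" for N
  proof -
    \<comment> \<open>\<open>N dvd m + (N - 1)\<close> says that \<open>m\<close> is congruent to 1
      modulo \<open>N\<close>, also when \<open>m = 0\<close>. So \<open>e\<close> collects the
      surviving terms except the linear one; these have degree above \<open>N\<close>, whence the
      error is a geometric tail.\<close>
    define e where "e = (\<lambda>m. (if N dvd m + (N - 1) \<and> m \<noteq> 1 then P m x else 0))"
    have 1: "(\<lambda>m. (1 / real N) *\<^sub>R (\<omega> N ^ (k * (N - 1)) *\<^sub>C \<omega> N ^ (k * m) *\<^sub>C P m x))
        sums ((1 / real N) *\<^sub>R (\<omega> N ^ (k * (N - 1)) *\<^sub>C f (\<omega> N ^ k *\<^sub>C x)))" for k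
    proof -
      have "(\<lambda>m. P m (\<omega> N ^ k *\<^sub>C x)) sums f (\<omega> N ^ k *\<^sub>C x)"
        using x' by (intro lim) (simp add: norm_scaleC nrm)
      then have "(\<lambda>m. \<omega> N ^ (k * m) *\<^sub>C P m x) sums f (\<omega> N ^ k *\<^sub>C x)"
        by (simp add: homogeneous_polynomial_scaleC[OF P] power_mult)
      then show ?thesis
        by (intro bounded_linear.sums[OF bounded_linear_scaleR_right]
            bounded_linear.sums[OF bounded_bilinear.bounded_linear_right[OF bounded_bilinear_scaleC]])
    qed
    have "(\<lambda>m. \<Sum>k<N. (1 / real N) *\<^sub>R (\<omega> N ^ (k * (N - 1)) *\<^sub>C \<omega> N ^ (k * m) *\<^sub>C P m x)) sums A N"
      unfolding A_def by (intro sums_sum 1)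
    moreover have "(\<Sum>k<N. (1 / real N) *\<^sub>R (\<omega> N ^ (k * (N - 1)) *\<^sub>C \<omega> N ^ (k * m) *\<^sub>C P m x))
        = (if N dvd m + (N - 1) then P m x else 0)" for m
    proof -
      have pow: "\<omega> N ^ (k * (N - 1)) * \<omega> N ^ (k * m) = \<omega> N ^ (k * (m + (N - 1)))" for k
        by (simp only: power_add[symmetric] add_mult_distrib2 add.commute)
      have "(\<Sum>k<N. (1 / real N) *\<^sub>R (\<omega> N ^ (k * (N - 1)) *\<^sub>C \<omega> N ^ (k * m) *\<^sub>C P m x))
          = (1 / real N) *\<^sub>R ((\<Sum>k<N. \<omega> N ^ (k * (m + (N - 1)))) *\<^sub>C P m x)"
        by (simp only: scaleC_scaleC pow scaleC_sum_left scaleR_sum_right)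
      also have "\<dots> = (1 / real N) *\<^sub>R ((if N dvd m + (N - 1) then of_nat N else 0) *\<^sub>C P m x)"
        unfolding \<omega>_def using N by (subst average_root_of_unity_powers) auto
      also have "\<dots> = (if N dvd m + (N - 1) then P m x else 0)"
        using N scaleC_of_real[of "real N" "P m x"] by simp
      finally show ?thesis .
    qed
    ultimately have "(\<lambda>m. if N dvd m + (N - 1) then P m x else 0) sums A N" by simp
    moreover have "(\<lambda>m. if m = 1 then P m x else 0) sums P 1 x"
      using sums_single[of 1 "\<lambda>m. P m x"] by simp
    ultimately have "(\<lambda>m. (if N dvd m + (N - 1) then P m x else 0) - (if m = 1 then P m x else 0))
        sums (A N - P 1 x)" by (rule sums_diff)
    moreover have "(if N dvd m + (N - 1) then P m x else 0) - (if m = 1 then P m x else 0) = e m" for m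
      using N by (auto simp: e_def)
    ultimately have "e sums (A N - P 1 x)" by simp
    moreover have "e m = 0" if "m < N" for m
    proof -
      have "\<not> N dvd m + (N - 1)" if "m \<noteq> 1"
      proof
        assume "N dvd m + (N - 1)"
        then obtain c where c: "m + (N - 1) = N * c" by blast
        with \<open>m < N\<close> N have "N * c < N * 2" by linarith
        then have "c < 2" by simp
        then consider "c = 0" | "c = 1" by linarith
        then show False using c N that by cases auto
      qed
      then show ?thesis by (auto simp: e_def)
    qed
    ultimately have s: "(\<lambda>m. e (m + N)) sums (A N - P 1 x)"
      by (subst sums_iff_shift) simp
    have g: "(\<lambda>m. M * (1/2) ^ N * (1/2) ^ m) sums (M * (1/2) ^ N * (1 / (1 - 1/2)))"
      by (intro sums_mult geometric_sums) simp
    have "norm (\<Sum>m. e (m + N)) \<le> (\<Sum>m. M * (1/2) ^ N * (1/2) ^ m)"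
    proof (rule norm_suminf_le)
      show "norm (e (m + N)) \<le> M * (1/2) ^ N * (1/2) ^ m" for m
        using Pm[of "m + N"] M(1) by (auto simp: e_def power_add mult_ac)
    qed (use g sums_summable in blast)
    then show ?thesis using s g by (simp add: sums_iff mult_ac)
  qed
  have "(\<lambda>N. 2 * M * (1/2) ^ N) \<longlonglongrightarrow> 2 * M * 0"
    by (intro tendsto_intros LIMSEQ_power_zero) auto
  then have "(\<lambda>N. 2 * M * (1/2) ^ N) \<longlonglongrightarrow> 0" by simp
  then have "(\<lambda>N. A N - P 1 x) \<longlonglongrightarrow> 0"
    by (rule Lim_null_comparison[rotated]) (use bound in \<open>auto simp: eventually_sequentially\<close>)
  then have "A \<longlonglongrightarrow> P 1 x" by (simp add: LIM_zero_iff)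
  then show ?thesis
    by (rule Lim_in_closed_set[OF C(1), rotated 2]) (use inC in \<open>auto simp: eventually_sequentially\<close>)
qed

section \<open>The weighted spaces and their topology\<close>

lemma compact_operator_bounded_linear:
  assumes "compact_operator T"
  shows "bounded_linear T"
proof -
  have lin: "complex_linear T" and "compact (closure (T ` cball 0 1))"
    using assms by (auto simp: compact_operator_def relatively_compact_def)
  then have "bounded (T ` cball 0 1)"
    using compact_imp_bounded bounded_subset closure_subset by blast
  then obtain B where B: "\<And>x. norm x \<le> 1 \<Longrightarrow> norm (T x) \<le> B"
    unfolding bounded_iff by (metis image_eqI mem_cball_0)
  show ?thesis
  proof (rule bounded_linear_intro[of _ B])
    fix x
    show "norm (T x) \<le> norm x * B"
    proof (cases "x = 0")
      case True
      then show ?thesis using complex_linearD(3)[OF lin, of 0 0] by simp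
    next
      case False
      then have "norm (T ((1 / norm x) *\<^sub>R x)) \<le> B" by (intro B) simp
      then show ?thesis using False by (simp add: complex_linearD(3)[OF lin] field_simps)
    qed
  qed (auto simp: complex_linearD[OF lin])
qed

text \<open>Each real functional is the real part of a complex one, hence of a polynomial in the
  weighted space. This bounds \<open>w x *\<^sub>R x\<close> weakly, and therefore in norm.\<close>

lemma weighted_identity_bounded:
  fixes U :: "'a::complex_banach set"
  assumes w: "\<And>x. x \<in> U \<Longrightarrow> 0 < w x"
    and pol: "(\<lambda>P. restrict P U) ` (continuous_polynomials :: ('a \<Rightarrow> complex) set) \<subseteq> Hw U w"
  obtains D where "0 < D" "\<And>x. x \<in> U \<Longrightarrow> w x * norm x \<le> D"
proof -
  have "bounded ((\<lambda>x. w x *\<^sub>R x) ` U)"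
  proof (rule weakly_bounded_imp_bounded)
    fix u :: "'a \<Rightarrow>\<^sub>L real"
    define \<phi> where "\<phi> = (\<lambda>x. Complex (blinfun_apply u x) (- blinfun_apply u (\<i> *\<^sub>C x)))"
    have "restrict \<phi> U \<in> Hw U w"
      using pol functional_in_continuous_polynomials complexify_functional(1)[of u]
      by (auto simp: \<phi>_def)
    then have "bdd_above ((\<lambda>x. w x * cmod (\<phi> x)) ` U)"
      by (simp add: Hw_def cong: image_cong)
    then obtain M where M: "\<And>x. x \<in> U \<Longrightarrow> w x * cmod (\<phi> x) \<le> M" by (auto simp: bdd_above_def)
    have "\<bar>blinfun_apply u (w x *\<^sub>R x)\<bar> \<le> M" if "x \<in> U" for x
    proof -
      have "\<bar>blinfun_apply u (w x *\<^sub>R x)\<bar> = w x * \<bar>Re (\<phi> x)\<bar>"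
        using w[OF that] by (simp add: \<phi>_def blinfun.bilinear_simps abs_mult)
      also have "\<dots> \<le> w x * cmod (\<phi> x)"
        using w[OF that] by (intro mult_left_mono abs_Re_le_cmod) auto
      finally show ?thesis using M[OF that] by simp
    qed
    then show "bounded (blinfun_apply u ` (\<lambda>x. w x *\<^sub>R x) ` U)" by (auto simp: bounded_iff)
  qed
  then obtain D where D: "\<And>x. x \<in> U \<Longrightarrow> norm (w x *\<^sub>R x) \<le> D" by (auto simp: bounded_iff)
  show ?thesis
  \<comment> \<open>The maximum makes the bound positive, so that one may divide by it.\<close>
  proof (rule that[of "max D 1"])
    show "w x * norm x \<le> max D 1" if "x \<in> U" for x
      using D[OF that] w[OF that] by simp
  qed simp
qed

lemma bounded_linear_in_Hw:
  assumes T: "complex_linear T" "bounded_linear T" and "open U"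
    and w: "\<And>x. x \<in> U \<Longrightarrow> 0 < w x" and D: "\<And>x. x \<in> U \<Longrightarrow> w x * norm x \<le> D"
  shows "restrict T U \<in> Hw U w"
proof -
  obtain K where K: "0 \<le> K" "\<And>x. norm (T x) \<le> norm x * K"
    using bounded_linear.nonneg_bounded[OF T(2)] by blast
  have "w x * norm (T x) \<le> D * K" if x: "x \<in> U" for x
  proof -
    have "w x * norm (T x) \<le> w x * (norm x * K)"
      using w[OF x] K(2)[of x] by (intro mult_left_mono) auto
    also have "\<dots> \<le> D * K" using mult_right_mono[OF D[OF x] K(1)] by (simp add: mult_ac)
    finally show ?thesis .
  qed
  then have "bdd_above ((\<lambda>x. w x * norm (restrict T U x)) ` U)"
    by (auto simp: bdd_above_def)
  moreover have "holomorphic_map U (restrict T U)"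
    by (rule bounded_linear_holomorphic_map[OF T \<open>open U\<close>]) simp
  ultimately show ?thesis by (simp add: Hw_def)
qed

text \<open>By linearity \<open>w x *\<^sub>R T x\<close> is \<open>D\<close> times the value of
  \<open>T\<close> at \<open>(w x / D) *\<^sub>R x\<close>, a point of the unit ball.\<close>

lemma compact_operator_in_Hwc:
  assumes T: "compact_operator T" and "open U"
    and w: "\<And>x. x \<in> U \<Longrightarrow> 0 < w x" and D: "0 < D" "\<And>x. x \<in> U \<Longrightarrow> w x * norm x \<le> D"
  shows "restrict T U \<in> Hwc U w"
proof -
  have lin: "complex_linear T" using T by (simp add: compact_operator_def)
  have "relatively_compact ((\<lambda>y. D *\<^sub>R y) ` T ` cball 0 1)"
    using T by (intro relatively_compact_closed_image[where f = "\<lambda>y. D *\<^sub>R y"] continuous_intros)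
       (simp add: compact_operator_def)
  moreover have "(\<lambda>x. w x *\<^sub>R restrict T U x) ` U \<subseteq> (\<lambda>y. D *\<^sub>R y) ` T ` cball 0 1"
  proof
    fix y assume "y \<in> (\<lambda>x. w x *\<^sub>R restrict T U x) ` U"
    then obtain x where x: "x \<in> U" "y = w x *\<^sub>R T x" by auto
    have "y = D *\<^sub>R T ((w x / D) *\<^sub>R x)"
      using x(2) D(1) by (simp add: complex_linearD(3)[OF lin])
    moreover have "(w x / D) *\<^sub>R x \<in> cball 0 1"
      using D(1) D(2)[OF x(1)] w[OF x(1)] by (simp add: field_simps)
    ultimately show "y \<in> (\<lambda>y. D *\<^sub>R y) ` T ` cball 0 1" by blast
  qed
  ultimately have "relatively_compact ((\<lambda>x. w x *\<^sub>R restrict T U x) ` U)"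
    by (rule relatively_compact_subset)
  then show ?thesis
    using bounded_linear_in_Hw[OF lin compact_operator_bounded_linear[OF T] \<open>open U\<close> w D(2)]
    by (simp add: Hwc_def)
qed

lemma INF_finite_weight:
  assumes "finite A" "A \<noteq> {}" "A \<subseteq> U" and w: "\<And>x. x \<in> U \<Longrightarrow> 0 < (w x :: real)"
  shows "0 \<le> (INF x\<in>A. w x)" "y \<in> A \<Longrightarrow> (INF x\<in>A. w x) \<le> w y"
proof -
  show "0 \<le> (INF x\<in>A. w x)"
    using assms by (intro cINF_greatest) (auto intro: less_imp_le)
  show "y \<in> A \<Longrightarrow> (INF x\<in>A. w x) \<le> w y"
    using assms by (intro cINF_lower bdd_below_finite) auto
qed

lemma tauM_seminorm_le:
  assumes A: "\<And>j. finite (A j)" "\<And>j. A j \<noteq> {}"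
    and le: "\<And>j y. y \<in> A j \<Longrightarrow> \<alpha> j * (INF x\<in>A j. w x) * norm (g y) \<le> c"
  shows "tauM_seminorm w \<alpha> A g \<le> c"
  unfolding tauM_seminorm_def
proof (rule cSUP_least)
  fix j
  have "(SUP y\<in>A j. norm (g y)) = Max ((\<lambda>y. norm (g y)) ` A j)"
    using A by (intro cSup_eq_Max) auto
  also have "\<dots> \<in> (\<lambda>y. norm (g y)) ` A j"
    using A by (intro Max_in) auto
  finally show "\<alpha> j * (INF x\<in>A j. w x) * (SUP y\<in>A j. norm (g y)) \<le> c"
    using le by auto
qed simp

text \<open>A real \<open>SUP\<close> dominates its terms only once they are known to be bounded.
  Here \<open>inf w * norm (g z) \<le> w z * norm (g z)\<close> is controlled by \<open>D\<close>,
  and a null sequence is bounded.\<close>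

lemma le_tauM_seminorm:
  assumes A: "\<And>j. finite (A j)" "\<And>j. A j \<noteq> {}" "\<And>j. A j \<subseteq> U"
    and w: "\<And>x. x \<in> U \<Longrightarrow> 0 < w x" and \<alpha>: "\<And>j. 0 \<le> \<alpha> j" "\<alpha> \<longlonglongrightarrow> 0"
    and D: "\<And>x. x \<in> U \<Longrightarrow> w x * norm (g x) \<le> D" and y: "y \<in> A j"
  shows "\<alpha> j * (INF x\<in>A j. w x) * norm (g y) \<le> tauM_seminorm w \<alpha> A g"
proof -
  have inf0: "0 \<le> (INF x\<in>A j. w x)" for j
    by (rule INF_finite_weight(1)[OF A w])
  have bdd: "bdd_above ((\<lambda>y. norm (g y)) ` A j)" for j
    using A(1) by (intro bdd_above_finite) auto
  obtain M where M: "\<And>j. \<alpha> j \<le> M"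
    using \<alpha>(2) by (metis convergentI convergent_imp_Bseq Bseq_def abs_le_D1 real_norm_def)
  have "\<alpha> j * (INF x\<in>A j. w x) * (SUP y\<in>A j. norm (g y)) \<le> M * \<bar>D\<bar>" for j
  proof -
    have "(SUP y\<in>A j. norm (g y)) = Max ((\<lambda>y. norm (g y)) ` A j)"
      using A by (intro cSup_eq_Max) auto
    also have "\<dots> \<in> (\<lambda>y. norm (g y)) ` A j"
      using A by (intro Max_in) auto
    finally obtain z where z: "z \<in> A j" "(SUP y\<in>A j. norm (g y)) = norm (g z)" by auto
    have "(INF x\<in>A j. w x) * norm (g z) \<le> w z * norm (g z)"
      using INF_finite_weight(2)[OF A w z(1)] by (intro mult_right_mono) auto
    also have "\<dots> \<le> \<bar>D\<bar>" using D[of z] z(1) A(3)[of j] by force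
    finally have "\<alpha> j * ((INF x\<in>A j. w x) * norm (g z)) \<le> M * \<bar>D\<bar>"
      using \<alpha>(1)[of j] M[of j] inf0[of j] by (intro mult_mono) auto
    then show ?thesis by (simp add: z(2) mult.assoc)
  qed
  then have "bdd_above (range (\<lambda>j. \<alpha> j * (INF x\<in>A j. w x) * (SUP y\<in>A j. norm (g y))))"
    by (intro bdd_aboveI2)
  then have "\<alpha> j * (INF x\<in>A j. w x) * (SUP y\<in>A j. norm (g y)) \<le> tauM_seminorm w \<alpha> A g"
    unfolding tauM_seminorm_def by (intro cSUP_upper) auto
  moreover have "\<alpha> j * (INF x\<in>A j. w x) * norm (g y) \<le> \<alpha> j * (INF x\<in>A j. w x) * (SUP y\<in>A j. norm (g y))"
    using \<alpha>(1) inf0[of j] y bdd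
    by (intro mult_left_mono cSUP_upper mult_nonneg_nonneg) auto
  ultimately show ?thesis by simp
qed

lemma Hw_diff_bound:
  assumes "f \<in> Hw U w" "g \<in> Hw U w" and w: "\<And>x. x \<in> U \<Longrightarrow> 0 < w x"
  obtains D where "\<And>x. x \<in> U \<Longrightarrow> w x * norm (f x - g x) \<le> D"
proof -
  obtain B C where B: "\<And>x. x \<in> U \<Longrightarrow> w x * norm (f x) \<le> B"
    and C: "\<And>x. x \<in> U \<Longrightarrow> w x * norm (g x) \<le> C"
    using assms(1,2) by (auto simp: Hw_def bdd_above_def)
  have "w x * norm (f x - g x) \<le> B + C" if "x \<in> U" for x
  proof -
    have "w x * norm (f x - g x) \<le> w x * (norm (f x) + norm (g x))"
      using w[OF that] by (intro mult_left_mono norm_triangle_ineq4) auto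
    then show ?thesis using B[OF that] C[OF that] by (simp add: distrib_left)
  qed
  then show ?thesis by (rule that)
qed

section \<open>From compact approximation to density\<close>

text \<open>Induction over the generated topology: intersections are handled by uniting the compact
  sets and taking the smaller tolerance. For a subbasic set, linearity moves the weight inside,
  \<open>c j * norm (T y - y) = norm (T (c j *\<^sub>R y) - c j *\<^sub>R y)\<close>, so only the
  points \<open>c j *\<^sub>R y\<close> matter.\<close>

lemma tauM_neighbourhood_of_inclusion:
  fixes U :: "'a::complex_banach set"
  assumes op: "openin (tauM U w) W" and IW: "(\<lambda>x\<in>U. x) \<in> W"
    and w: "\<And>x. x \<in> U \<Longrightarrow> 0 < w x" and D: "\<And>x. x \<in> U \<Longrightarrow> w x * norm x \<le> D"
    and I: "(\<lambda>x\<in>U. x) \<in> Hw U w"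
    and Hw: "\<And>T :: 'a \<Rightarrow> 'a. compact_operator T \<Longrightarrow> restrict T U \<in> Hw U w"
  shows "\<exists>K \<delta>. compact K \<and> K \<noteq> {} \<and> 0 < \<delta> \<and>
    (\<forall>T. compact_operator T \<and> (\<forall>x\<in>K. norm (T x - x) < \<delta>) \<longrightarrow> restrict T U \<in> W)"
  using op IW unfolding tauM_def openin_topology_generated_by_iff
proof (induction rule: generate_topology_on.induct)
  case Empty
  then show ?case by simp
next
  case (Int V W)
  obtain K \<delta> where K: "compact K" "K \<noteq> {}" "0 < \<delta>"
    "\<forall>T. compact_operator T \<and> (\<forall>x\<in>K. norm (T x - x) < \<delta>) \<longrightarrow> restrict T U \<in> V"
    using Int.IH(1) Int.prems by blast
  obtain L \<eta> where L: "compact L" "L \<noteq> {}" "0 < \<eta>"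
    "\<forall>T. compact_operator T \<and> (\<forall>x\<in>L. norm (T x - x) < \<eta>) \<longrightarrow> restrict T U \<in> W"
    using Int.IH(2) Int.prems by blast
  have "\<forall>T. compact_operator T \<and> (\<forall>x\<in>K \<union> L. norm (T x - x) < min \<delta> \<eta>) \<longrightarrow> restrict T U \<in> V \<inter> W"
    using K(4) L(4) by simp
  moreover have "compact (K \<union> L)" "K \<union> L \<noteq> {}" "0 < min \<delta> \<eta>"
    using K(1-3) L(1-3) by (auto simp: compact_Un)
  ultimately show ?case by blast
next
  case (UN \<K>)
  then obtain V where V: "V \<in> \<K>" "(\<lambda>x\<in>U. x) \<in> V" by blast
  obtain K \<delta> where K: "compact K" "K \<noteq> {}" "0 < \<delta>"
    "\<forall>T. compact_operator T \<and> (\<forall>x\<in>K. norm (T x - x) < \<delta>) \<longrightarrow> restrict T U \<in> V"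
    using UN.IH[OF V] by blast
  then show ?case
    using V(1) by (intro exI[of _ K] exI[of _ \<delta>]) blast
next
  case (Basis W)
  then obtain f \<alpha> A \<epsilon> where W: "W = {g \<in> Hw U w. tauM_seminorm w \<alpha> A (\<lambda>x. g x - f x) < \<epsilon>}"
    and f: "f \<in> Hw U w" and \<alpha>: "\<And>j. 0 \<le> \<alpha> j" "\<alpha> \<longlonglongrightarrow> 0"
    and A: "\<And>j. finite (A j)" "\<And>j. A j \<noteq> {}" "\<And>j. A j \<subseteq> U"
    by auto
  \<comment> \<open>The ball is centred at an arbitrary \<open>f\<close>; \<open>p\<close> is the
    seminorm distance of the inclusion from it. Half of the slack \<open>\<epsilon> - p\<close> is
    used as tolerance, so that the supremum stays strictly below \<open>\<epsilon>\<close>.\<close>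
  define p where "p = tauM_seminorm w \<alpha> A (\<lambda>x. (\<lambda>x\<in>U. x) x - f x)"
  have p: "p < \<epsilon>" using Basis W by (simp add: p_def)
  obtain D' where D': "\<And>x. x \<in> U \<Longrightarrow> w x * norm ((\<lambda>x\<in>U. x) x - f x) \<le> D'"
    by (rule Hw_diff_bound[OF I f w]) blast+
  define c where "c = (\<lambda>j. \<alpha> j * (INF x\<in>A j. w x))"
  have c: "0 \<le> c j" for j
    unfolding c_def by (intro mult_nonneg_nonneg \<alpha>(1) INF_finite_weight(1)[OF A w])
  define X where "X = (\<lambda>j. (\<lambda>y. c j *\<^sub>R y) ` A j)"
  define K where "K = insert 0 (\<Union>j. X j)"
  have "compact K"
    unfolding K_def
  proof (rule compact_insert_null_blocks[of _ "\<lambda>j. \<alpha> j * D"])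
    show "finite (X j)" for j using A(1) by (simp add: X_def)
    show "norm x \<le> \<alpha> j * D" if x: "x \<in> X j" for j x
    proof -
      obtain y where y: "y \<in> A j" "x = c j *\<^sub>R y" using x by (auto simp: X_def)
      have "(INF x\<in>A j. w x) * norm y \<le> w y * norm y"
        using INF_finite_weight(2)[OF A w y(1)] by (intro mult_right_mono) auto
      also have "\<dots> \<le> D" using D y(1) A(3) by blast
      finally have "\<alpha> j * ((INF x\<in>A j. w x) * norm y) \<le> \<alpha> j * D"
        using \<alpha>(1) by (intro mult_left_mono)
      then show ?thesis using c[of j] by (simp add: y(2) c_def mult.assoc)
    qed
    show "(\<lambda>j. \<alpha> j * D) \<longlonglongrightarrow> 0" by (rule tendsto_mult_left_zero[OF \<alpha>(2)])
  qed
  moreover have "restrict T U \<in> W" if T: "compact_operator T" "\<forall>x\<in>K. norm (T x - x) < (\<epsilon> - p) / 2" for T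
  proof -
    have lin: "complex_linear T" using T by (simp add: compact_operator_def)
    have "tauM_seminorm w \<alpha> A (\<lambda>x. restrict T U x - f x) \<le> (\<epsilon> - p) / 2 + p"
    proof (rule tauM_seminorm_le[OF A(1,2)])
      fix j y assume y: "y \<in> A j"
      then have yU: "y \<in> U" using A(3) by blast
      have "c j * norm (T y - y) = norm (T (c j *\<^sub>R y) - c j *\<^sub>R y)"
        using c[of j] by (simp add: complex_linearD(3)[OF lin] flip: scaleR_diff_right)
      also have "\<dots> \<le> (\<epsilon> - p) / 2"
        using T(2) y by (intro less_imp_le) (auto simp: K_def X_def)
      finally have 1: "c j * norm (T y - y) \<le> (\<epsilon> - p) / 2" .
      have 2: "c j * norm (y - f y) \<le> p"
        using le_tauM_seminorm[where A = A and w = w and \<alpha> = \<alpha> and U = U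
            and g = "\<lambda>x. (\<lambda>x\<in>U. x) x - f x", OF A w \<alpha> D' y] yU by (simp add: c_def p_def)
      have "c j * norm (T y - f y) \<le> c j * (norm (T y - y) + norm (y - f y))"
        using c norm_triangle_ineq[of "T y - y" "y - f y"] by (intro mult_left_mono) auto
      then have "c j * norm (T y - f y) \<le> (\<epsilon> - p) / 2 + p"
        using 1 2 unfolding distrib_left by linarith
      then show "\<alpha> j * (INF x\<in>A j. w x) * norm (restrict T U y - f y) \<le> (\<epsilon> - p) / 2 + p"
        using yU by (simp add: c_def)
    qed
    also have "\<dots> < \<epsilon>" using p by (simp add: field_simps)
    finally show ?thesis using Hw[OF T(1)] by (simp add: W)
  qed
  moreover have "K \<noteq> {}" "0 < (\<epsilon> - p) / 2" using p by (auto simp: K_def)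
  ultimately show ?case by blast
qed

section \<open>From density to compact approximation\<close>

lemma weight_bounded_below_near_0:
  assumes "open U" "0 \<in> U" "weight U w"
  obtains R c where "0 < R" "cball 0 R \<subseteq> U" "0 < c" "\<And>x. x \<in> cball 0 R \<Longrightarrow> c \<le> w x"
proof -
  obtain r where r: "r > 0" "ball 0 r \<subseteq> U" using assms by (meson open_contains_ball)
  have sub: "cball 0 (r / 2) \<subseteq> U" using r by (auto simp: subset_iff)
  have "U_bounded U (cball 0 (r / 2))"
    unfolding U_bounded_def
  proof (intro conjI exI[of _ "ball 0 (r / 2)"] ballI sub)
    fix a v :: 'a assume "a \<in> cball 0 (r / 2)" "v \<in> ball 0 (r / 2)"
    then show "a + v \<in> U" using r(2) norm_triangle_ineq[of a v] by (auto simp: subset_iff)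
  qed (use r in auto)
  then have "0 < (INF x\<in>cball 0 (r / 2). w x)"
    using assms(3) r(1) unfolding weight_def by (metis cball_eq_empty half_gt_zero not_less_iff_gr_or_eq)
  moreover have "(INF x\<in>cball 0 (r / 2). w x) \<le> w x" if "x \<in> cball 0 (r / 2)" for x
  proof (rule cINF_lower[OF _ that])
    show "bdd_below (w ` cball 0 (r / 2))"
      using assms(3) sub unfolding weight_def by (intro bdd_belowI2[of _ 0]) (meson less_imp_le subsetD)
  qed
  ultimately show ?thesis using that[of "r / 2"] r(1) sub by simp
qed

text \<open>Near 0 the weight is at least \<open>c\<close>, so unimodular multiples of values of
  \<open>f\<close> are multiples, by scalars of modulus at most \<open>1 / c\<close>, of points in
  the relatively compact range of \<open>w f\<close>. Averaging over roots of unity places the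
  linear term in the closed convex hull of these.\<close>

lemma Hwc_derivative_at_0:
  fixes f :: "'a::complex_banach \<Rightarrow> 'b::complex_banach"
  assumes f: "f \<in> Hwc U w" and U: "open U" "0 \<in> U" "weight U w"
  obtains T where "compact_operator T"
    "\<And>\<phi> v. complex_functional \<phi> \<Longrightarrow> ((\<lambda>t. \<phi> (f (t *\<^sub>C v))) has_field_derivative \<phi> (T v)) (at 0)"
proof -
  have hol: "holomorphic_map U f" and rc: "compact (closure ((\<lambda>x. w x *\<^sub>R f x) ` U))"
    using f by (auto simp: Hwc_def Hw_def relatively_compact_def)
  obtain R c where R: "0 < R" "cball 0 R \<subseteq> U" and c: "0 < c" "\<And>x. x \<in> cball 0 R \<Longrightarrow> c \<le> w x"
    by (rule weight_bounded_below_near_0[OF U]) blast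
  obtain r0 P where r0: "r0 > 0" and P: "\<And>m. continuous_homogeneous_polynomial m (P m)"
    and lim: "uniform_limit (ball 0 r0) (\<lambda>n x. \<Sum>m<n. P m (x - 0)) f sequentially"
    using hol U(2) unfolding holomorphic_map_def by meson
  define r where "r = min r0 R"
  have r: "r > 0" using r0 R by (simp add: r_def)
  have sums: "(\<lambda>m. P m x) sums f x" if "x \<in> ball 0 r" for x
    using tendsto_uniform_limitI[OF lim, of x] that by (simp add: r_def sums_def)
  define C where "C = closure (convex hull ((\<lambda>(s, z). s *\<^sub>C z) `
    (cball 0 (1 / c) \<times> closure ((\<lambda>x. w x *\<^sub>R f x) ` U))))"
  have "compact C"
    unfolding C_def case_prod_unfold
    by (intro compact_closure_convex_hull compact_continuous_image continuous_intros
        compact_Times compact_cball rc)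
  have PC: "P 1 x \<in> C" if x: "2 *\<^sub>R x \<in> ball 0 r" for x
  proof (rule linear_coefficient_in_closed_convex[OF P sums _ _ _ x])
    show "closed C" "convex C" by (auto simp: C_def convex_closure)
    fix s and y :: 'a assume s: "cmod s = 1" and y: "y \<in> ball 0 r"
    have yR: "y \<in> cball 0 R" using y by (simp add: r_def)
    then have wy: "c \<le> w y" by (rule c(2))
    have "s *\<^sub>C f y = (s / complex_of_real (w y)) *\<^sub>C (w y *\<^sub>R f y)"
      using wy c(1) by (simp add: scaleC_scaleC flip: scaleC_of_real)
    moreover have "s / complex_of_real (w y) \<in> cball 0 (1 / c)"
      using wy c(1) s by (simp add: norm_divide frac_le)
    moreover have "w y *\<^sub>R f y \<in> closure ((\<lambda>x. w x *\<^sub>R f x) ` U)"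
      by (intro subsetD[OF closure_subset] imageI subsetD[OF R(2) yR])
    ultimately show "s *\<^sub>C f y \<in> C"
      unfolding C_def
      by (intro subsetD[OF closure_subset] hull_inc
          image_eqI[of _ _ "(s / complex_of_real (w y), w y *\<^sub>R f y)"]) simp_all
  qed
  have lin: "complex_linear (P 1)" by (rule homogeneous_polynomial_1_linear[OF P])
  have "compact_operator (P 1)"
    unfolding compact_operator_def
  proof (intro conjI lin relatively_compactI)
    show "compact ((\<lambda>y. (4 / r) *\<^sub>R y) ` C)" using \<open>compact C\<close> by (rule compact_scaling)
    show "P 1 ` cball 0 1 \<subseteq> (\<lambda>y. (4 / r) *\<^sub>R y) ` C"
    proof (rule image_subsetI)
      fix x :: 'a assume x: "x \<in> cball 0 1"
      \<comment> \<open>The factor \<open>r / 4\<close> keeps even the doubled point strictly inside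
        the ball of radius \<open>r\<close>.\<close>
      have "r * norm x \<le> r * 1" using x r by (intro mult_left_mono) auto
      then have "2 *\<^sub>R ((r / 4) *\<^sub>R x) \<in> ball 0 r" using r by simp
      then have "P 1 ((r / 4) *\<^sub>R x) \<in> C" by (rule PC)
      moreover have "P 1 x = (4 / r) *\<^sub>R P 1 ((r / 4) *\<^sub>R x)"
        using r by (subst complex_linearD(3)[OF lin]) simp
      ultimately show "P 1 x \<in> (\<lambda>y. (4 / r) *\<^sub>R y) ` C" by blast
    qed
  qed
  moreover have "((\<lambda>t. \<phi> (f (t *\<^sub>C v))) has_field_derivative \<phi> (P 1 v)) (at 0)"
    if "complex_functional \<phi>" for \<phi> v
    by (rule deriv_along_line[OF P sums r that])
  ultimately show ?thesis by (rule that)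
qed

lemma tauM_closure_imp_compact_approximation:
  fixes U :: "'a::complex_banach set"
  assumes U: "open U" "0 \<in> U" "weight U w"
    and cl: "(\<lambda>x\<in>U. x) \<in> tauM U w closure_of Hwc U w"
    and I: "(\<lambda>x\<in>U. x) \<in> Hw U w"
    and K: "compact K" "K \<noteq> {}" and "0 < \<epsilon>"
  shows "\<exists>T :: 'a \<Rightarrow> 'a. compact_operator T \<and> (SUP x\<in>K. norm (T x - x)) < \<epsilon>"
proof -
  have w: "0 < w x" if "x \<in> U" for x using U(3) that by (simp add: weight_def)
  obtain R c where R: "0 < R" "cball 0 R \<subseteq> U" and c: "0 < c" "\<And>x. x \<in> cball 0 R \<Longrightarrow> c \<le> w x"
    by (rule weight_bounded_below_near_0[OF U]) blast
  define \<rho> where "\<rho> = R / 2"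
  have \<rho>: "0 < \<rho>" using R by (simp add: \<rho>_def)
  \<comment> \<open>Rescaling to norm \<open>\<rho> = R / 2\<close> keeps the disc of radius 2
    through \<open>hat v\<close> in \<open>cball 0 R\<close>. Division by zero gives
    \<open>hat 0 = 0\<close>, so \<open>hat_v\<close> holds there too.\<close>
  define hat :: "'a \<Rightarrow> 'a" where "hat = (\<lambda>v. (\<rho> / norm v) *\<^sub>R v)"
  have hat_R: "t *\<^sub>C hat v \<in> cball 0 R" if "t \<in> cball 0 2" for t v
  proof -
    have "norm (hat v) \<le> \<rho>" using \<rho> by (simp add: hat_def)
    then have "cmod t * norm (hat v) \<le> 2 * \<rho>" using that by (intro mult_mono) auto
    then show ?thesis by (simp add: norm_scaleC \<rho>_def)
  qed
  have hat_v: "v = (norm v / \<rho>) *\<^sub>R hat v" for v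
    using \<rho> by (simp add: hat_def)
  obtain B C where B: "\<And>n. finite (B n)" "0 < C" "\<And>n v. v \<in> B n \<Longrightarrow> norm v \<le> C * (1/4) ^ n"
    and KB: "\<And>x. x \<in> K \<Longrightarrow> \<exists>v. (\<forall>n. v n \<in> B n) \<and> v sums x"
    by (rule compact_telescoping_nets[OF K(1)]) blast
  obtain N :: "nat \<Rightarrow> complex set"
    where N: "\<And>n. finite (N n)" "\<And>n. N n \<subseteq> cball 0 2"
    and sampling: "\<And>(G :: complex \<Rightarrow> 'a) S n P t.
      \<lbrakk>open S; cball 0 2 \<subseteq> S; \<And>\<phi>. complex_functional \<phi> \<Longrightarrow> (\<lambda>t. \<phi> (G t)) holomorphic_on S;
        bounded (G ` cball 0 2); \<And>k t. n \<le> k \<Longrightarrow> t \<in> N k \<Longrightarrow> norm (G t) \<le> 2 ^ k * P; 0 \<le> P;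
        t \<in> cball 0 1\<rbrakk> \<Longrightarrow> norm (G t) \<le> 2 * 2 ^ n * P"
    by (rule sampling_nets) blast
  \<comment> \<open>Taking all \<open>B n\<close> with \<open>n \<le> j\<close> ensures that a
    vector of \<open>B n\<close> is sampled at every level from \<open>n\<close> on; the inserted
    \<open>0\<close> keeps the sets nonempty.\<close>
  define A where "A = (\<lambda>j. insert 0 ((\<lambda>(t, v). t *\<^sub>C hat v) ` (N j \<times> (\<Union>n\<le>j. B n))))"
  \<comment> \<open>These weights permit errors growing like \<open>2 ^ j\<close>, exactly what the
    sampling nets tolerate.\<close>
  define \<alpha> where "\<alpha> = (\<lambda>j. (1/2::real) ^ j)"
  \<comment> \<open>Chosen so that
    \<open>(C / \<rho>) * 2 * (\<epsilon>' / c) = \<epsilon> / 4\<close>.\<close>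
  define \<epsilon>' where "\<epsilon>' = \<epsilon> * \<rho> * c / (8 * C)"
  have \<epsilon>': "0 < \<epsilon>'" using \<open>0 < \<epsilon>\<close> \<rho> c(1) B(2) by (simp add: \<epsilon>'_def)
  have A_R: "A j \<subseteq> cball 0 R" for j
    using N(2)[of j] hat_R R(1) unfolding A_def by auto
  have A: "\<And>j. finite (A j)" "\<And>j. A j \<noteq> {}" "\<And>j. A j \<subseteq> U"
    using A_R R(2) N(1) B(1) by (auto simp: A_def)
  have \<alpha>: "\<And>j. 0 \<le> \<alpha> j" "\<alpha> \<longlonglongrightarrow> 0"
    unfolding \<alpha>_def by (auto intro: LIMSEQ_power_zero)
  define W where "W = {g \<in> Hw U w. tauM_seminorm w \<alpha> A (\<lambda>x. g x - (\<lambda>x\<in>U. x) x) < \<epsilon>'}"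
  have "openin (tauM U w) W"
    unfolding tauM_def
  proof (rule topology_generated_by_Basis)
    show "W \<in> {{g \<in> Hw U w. tauM_seminorm w \<alpha> A (\<lambda>x. g x - f x) < \<epsilon>} | f \<alpha> A \<epsilon>.
      f \<in> Hw U w \<and> 0 < \<epsilon> \<and> (\<forall>j. 0 \<le> \<alpha> j) \<and> \<alpha> \<longlonglongrightarrow> 0 \<and>
      (\<forall>j. finite (A j) \<and> A j \<noteq> {} \<and> A j \<subseteq> U)}"
      unfolding W_def using I \<epsilon>' \<alpha> A by blast
  qed
  moreover have "(\<lambda>x\<in>U. x) \<in> W"
    using I \<epsilon>' tauM_seminorm_le[where A = A, OF A(1,2), where g = "\<lambda>x. (\<lambda>x\<in>U. x) x - (\<lambda>x\<in>U. x) x"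
      and \<alpha> = \<alpha> and w = w and c = 0]
    by (simp add: W_def)
  ultimately obtain f where f: "f \<in> Hwc U w" "f \<in> W"
    using cl unfolding in_closure_of by blast
  have fHw: "f \<in> Hw U w" using f(1) by (simp add: Hwc_def)
  obtain T where T: "compact_operator T"
    and deriv: "\<And>\<phi> v. complex_functional \<phi> \<Longrightarrow>
      ((\<lambda>t. \<phi> (f (t *\<^sub>C v))) has_field_derivative \<phi> (T v)) (at 0)"
    by (rule Hwc_derivative_at_0[OF f(1) U]) blast
  obtain D where D: "\<And>x. x \<in> U \<Longrightarrow> w x * norm (f x - (\<lambda>x\<in>U. x) x) \<le> D"
    by (rule Hw_diff_bound[OF fHw I w]) blast+
  have near: "norm (f x - x) \<le> 2 ^ j * (\<epsilon>' / c)" if "x \<in> A j" for x j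
  proof -
    have xU: "x \<in> U" using that A(3) by blast
    have "\<alpha> j * (INF x\<in>A j. w x) * norm (f x - x) < \<epsilon>'"
      using le_tauM_seminorm[where A = A and w = w and \<alpha> = \<alpha> and U = U
          and g = "\<lambda>x. f x - (\<lambda>x\<in>U. x) x", OF A w \<alpha> D that] f(2) xU by (simp add: W_def)
    moreover have "c \<le> (INF x\<in>A j. w x)"
      using A(2) by (intro cINF_greatest c(2) subsetD[OF A_R])
    then have "\<alpha> j * c * norm (f x - x) \<le> \<alpha> j * (INF x\<in>A j. w x) * norm (f x - x)"
      using \<alpha>(1) by (intro mult_right_mono mult_left_mono) auto
    ultimately have "\<alpha> j * c * norm (f x - x) \<le> \<epsilon>'" by linarith
    then show ?thesis using c(1) by (simp add: \<alpha>_def field_simps power_one_over)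
  qed
  have lin: "complex_linear T" using T by (simp add: compact_operator_def)
  have blT: "bounded_linear T" by (rule compact_operator_bounded_linear[OF T])
  \<comment> \<open>Sampling from level \<open>n\<close> on loses \<open>2 ^ n\<close>, but
    \<open>norm v\<close> is at most \<open>C * (1/4) ^ n\<close>; the product still decays like
    \<open>(1/2) ^ n\<close>, and these bounds sum to \<open>\<epsilon> / 2\<close>.\<close>
  have B_est: "norm (T v - v) \<le> \<epsilon> / 4 * (1/2) ^ n" if v: "v \<in> B n" for v n
  proof -
    define G where "G = (\<lambda>t. f (t *\<^sub>C hat v) - t *\<^sub>C hat v)"
    define S where "S = (\<lambda>t. t *\<^sub>C hat v) -` U"
    have "open S"
      unfolding S_def by (intro open_vimage U continuous_intros)
    have "cball 0 2 \<subseteq> S" unfolding S_def by (intro subsetI vimageI2 subsetD[OF R(2)] hat_R)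
    have \<phi>G: "\<phi> (G t) = \<phi> (f (t *\<^sub>C hat v)) - t * \<phi> (hat v)" if "complex_functional \<phi>" for \<phi> t
    proof -
      have "complex_linear \<phi>" using that by (simp add: complex_functional_def)
      then show ?thesis
        unfolding G_def by (simp add: linear_diff[OF complex_linearD(4)] complex_linearD(2) scaleC_complex_def)
    qed
    have hol: "(\<lambda>t. \<phi> (G t)) holomorphic_on S" if "complex_functional \<phi>" for \<phi>
    proof -
      have "holomorphic_map U f" using fHw by (simp add: Hw_def)
      then have "(\<lambda>t. \<phi> (f (t *\<^sub>C hat v))) holomorphic_on S"
        by (rule holomorphic_map_along_line[OF _ that \<open>open S\<close>]) (simp add: S_def)
      then show ?thesis by (simp add: \<phi>G[OF that] holomorphic_intros)
    qed
    have "norm (G t) \<le> D / c" if "t \<in> cball 0 2" for t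
    proof -
      have y: "t *\<^sub>C hat v \<in> cball 0 R" "t *\<^sub>C hat v \<in> U" using hat_R[OF that] R(2) by auto
      have "c * norm (G t) \<le> w (t *\<^sub>C hat v) * norm (G t)"
        by (intro mult_right_mono c(2) y) simp
      also have "\<dots> \<le> D" using D[OF y(2)] y(2) by (simp add: G_def)
      finally show ?thesis using c(1) by (simp add: field_simps)
    qed
    then have "bounded (G ` cball 0 2)" unfolding bounded_iff by blast
    have G1: "norm (G t) \<le> 2 * 2 ^ n * (\<epsilon>' / c)" if "t \<in> cball 0 1" for t
    proof (rule sampling[OF \<open>open S\<close> \<open>cball 0 2 \<subseteq> S\<close> hol \<open>bounded (G ` cball 0 2)\<close> _ _ that])
      fix k t assume "n \<le> k" "t \<in> N k"
      then have "t *\<^sub>C hat v \<in> A k" using v by (force simp: A_def)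
      then show "norm (G t) \<le> 2 ^ k * (\<epsilon>' / c)" unfolding G_def by (rule near)
    qed (use \<epsilon>' c(1) in auto)
    have "norm (T (hat v) - hat v) \<le> 2 * 2 ^ n * (\<epsilon>' / c)"
    proof -
      obtain \<phi> where \<phi>: "complex_functional \<phi>" "\<And>x. cmod (\<phi> x) \<le> norm x"
          "norm (T (hat v) - hat v) \<le> cmod (\<phi> (T (hat v) - hat v))"
        by (rule complex_Hahn_Banach_norming[of "T (hat v) - hat v"]) blast
      have lin\<phi>: "linear \<phi>" using \<phi>(1) by (auto simp: complex_functional_def dest: complex_linearD(4))
      have "((\<lambda>t. \<phi> (G t)) has_field_derivative \<phi> (T (hat v)) - \<phi> (hat v)) (at 0)"
        unfolding \<phi>G[OF \<phi>(1)] by (auto intro!: derivative_eq_intros deriv[OF \<phi>(1)])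
      then have d: "deriv (\<lambda>t. \<phi> (G t)) 0 = \<phi> (T (hat v) - hat v)"
        by (simp add: DERIV_imp_deriv linear_diff[OF lin\<phi>])
      have sub: "cball 0 1 \<subseteq> S" using \<open>cball 0 2 \<subseteq> S\<close> by (auto simp: subset_iff)
      have "norm ((deriv ^^ 1) (\<lambda>t. \<phi> (G t)) 0) \<le> fact 1 * (2 * 2 ^ n * (\<epsilon>' / c)) / 1 ^ 1"
      proof (rule Cauchy_inequality)
        show "(\<lambda>t. \<phi> (G t)) holomorphic_on ball 0 1"
          by (rule holomorphic_on_subset[OF hol[OF \<phi>(1)]]) (use sub in auto)
        show "continuous_on (cball 0 1) (\<lambda>t. \<phi> (G t))"
          by (intro holomorphic_on_imp_continuous_on holomorphic_on_subset[OF hol[OF \<phi>(1)] sub])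
        show "cmod (\<phi> (G t)) \<le> 2 * 2 ^ n * (\<epsilon>' / c)" if "cmod (0 - t) = 1" for t
          by (rule order_trans[OF \<phi>(2) G1]) (use that in simp)
      qed simp
      then show ?thesis using \<phi>(3) d by simp
    qed
    moreover have "T v - v = (norm v / \<rho>) *\<^sub>R (T (hat v) - hat v)"
      using hat_v[of v] complex_linearD(3)[OF lin, of "norm v / \<rho>" "hat v"]
      by (simp add: scaleR_diff_right)
    then have "norm (T v - v) = (norm v / \<rho>) * norm (T (hat v) - hat v)"
      using \<rho> by simp
    ultimately have "norm (T v - v) \<le> (norm v / \<rho>) * (2 * 2 ^ n * (\<epsilon>' / c))"
      using \<rho> by (metis mult_left_mono divide_nonneg_pos norm_ge_zero)
    also have "\<dots> \<le> (C * (1/4) ^ n / \<rho>) * (2 * 2 ^ n * (\<epsilon>' / c))"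
      using \<rho> \<epsilon>' c(1) B(3)[OF v] by (intro mult_right_mono divide_right_mono) auto
    also have "\<dots> = \<epsilon> / 4 * ((1/4) ^ n * 2 ^ n)"
      using \<rho> c(1) B(2) by (simp add: \<epsilon>'_def field_simps)
    also have "(1/4) ^ n * 2 ^ n = (1/2 :: real) ^ n" by (simp flip: power_mult_distrib)
    finally show ?thesis .
  qed
  have "norm (T x - x) \<le> \<epsilon> / 2" if x: "x \<in> K" for x
  proof -
    obtain v where v: "\<And>n. v n \<in> B n" "v sums x" using KB[OF x] by blast
    have s: "(\<lambda>n. T (v n) - v n) sums (T x - x)"
      by (intro sums_diff bounded_linear.sums[OF blT] v(2))
    have g: "(\<lambda>n. \<epsilon> / 4 * (1/2) ^ n) sums (\<epsilon> / 4 * (1 / (1 - 1/2)))"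
      by (intro sums_mult geometric_sums) simp
    have "norm (\<Sum>n. T (v n) - v n) \<le> (\<Sum>n. \<epsilon> / 4 * (1/2) ^ n)"
      by (rule norm_suminf_le[OF B_est[OF v(1)]]) (use g sums_summable in blast)
    then show ?thesis using s g by (simp add: sums_iff)
  qed
  then have "(SUP x\<in>K. norm (T x - x)) \<le> \<epsilon> / 2"
    using K(2) by (intro cSUP_least)
  then show ?thesis using T \<open>0 < \<epsilon>\<close> by (intro exI[of _ T]) auto
qed

theorem theorem3p6:
  fixes U :: "'a::complex_banach set" and w :: "'a \<Rightarrow> real"
  assumes "open U" and "U \<noteq> {}" and "balanced U"
    and "weight U w" and "radial U w"
    and "(\<lambda>P. restrict P U) ` (continuous_polynomials :: ('a \<Rightarrow> complex) set) \<subseteq> Hw U w"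
  shows "compact_approximation_property TYPE('a) \<longleftrightarrow>
    (\<lambda>x\<in>U. x) \<in> tauM U w closure_of Hwc U w"
proof -
  have "0 \<in> U" using assms(2,3) by (force simp: balanced_def dest: bspec[where x = "_::'a"] spec[of _ 0])
  have w: "0 < w x" if "x \<in> U" for x using assms(4) that by (simp add: weight_def)
  obtain D where D: "0 < D" "\<And>x. x \<in> U \<Longrightarrow> w x * norm x \<le> D"
    by (rule weighted_identity_bounded[OF w assms(6)]) blast+
  have I: "(\<lambda>x\<in>U. x) \<in> Hw U w"
    by (rule bounded_linear_in_Hw[OF _ bounded_linear_ident assms(1) w D(2)])
       (simp add: complex_linear_def)
  have Hwc: "restrict T U \<in> Hwc U w" if "compact_operator T" for T :: "'a \<Rightarrow> 'a"
    by (rule compact_operator_in_Hwc[OF that assms(1) w D])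
  show ?thesis
  proof
    assume cap: "compact_approximation_property TYPE('a)"
    \<comment> \<open>Membership in a closure includes membership in the topological space, here the
      union of the generating sets; a seminorm with zero coefficients supplies one that contains the
      inclusion.\<close>
    have top: "(\<lambda>x\<in>U. x) \<in> topspace (tauM U w)"
    proof -
      define A where "A = (\<lambda>j::nat. {0::'a})"
      have "tauM_seminorm w (\<lambda>_. 0) A (\<lambda>x. (\<lambda>x\<in>U. x) x - (\<lambda>x\<in>U. x) x) < 1"
        by (simp add: tauM_seminorm_def)
      then show ?thesis
        unfolding tauM_def topology_generated_by_topspace using I \<open>0 \<in> U\<close>
        by (intro UnionI[of "{g \<in> Hw U w. tauM_seminorm w (\<lambda>_. 0) A (\<lambda>x. g x - (\<lambda>x\<in>U. x) x) < 1}"] CollectI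
            exI[of _ "\<lambda>x\<in>U. x"] exI[of _ "\<lambda>_. 0"] exI[of _ A] exI[of _ 1]) (auto simp: A_def)
    qed
    have "\<exists>g\<in>Hwc U w. g \<in> W" if W: "openin (tauM U w) W" "(\<lambda>x\<in>U. x) \<in> W" for W
    proof -
      have "restrict T U \<in> Hw U w" if "compact_operator T" for T :: "'a \<Rightarrow> 'a"
        using Hwc[OF that] by (simp add: Hwc_def)
      then obtain K \<delta> where K: "compact K" "K \<noteq> {}" "0 < \<delta>"
        "\<forall>T. compact_operator T \<and> (\<forall>x\<in>K. norm (T x - x) < \<delta>) \<longrightarrow> restrict T U \<in> W"
        using tauM_neighbourhood_of_inclusion[OF W w D(2) I] by blast
      obtain T :: "'a \<Rightarrow> 'a" where T: "compact_operator T" "(SUP x\<in>K. norm (T x - x)) < \<delta>"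
        using cap K(1-3) unfolding compact_approximation_property_def by blast
      \<comment> \<open>A bound on the real \<open>SUP\<close> controls the individual values only
        because they are bounded on the compact \<open>K\<close>.\<close>
      have "continuous_on K (\<lambda>x. norm (T x - x))"
        by (intro continuous_intros linear_continuous_on compact_operator_bounded_linear T)
      then have "bdd_above ((\<lambda>x. norm (T x - x)) ` K)"
        using K(1) by (intro bounded_imp_bdd_above compact_imp_bounded compact_continuous_image)
      then have "norm (T x - x) < \<delta>" if "x \<in> K" for x
        using cSUP_upper[OF that] T(2) by (meson le_less_trans)
      then have "restrict T U \<in> W" using K(4) T(1) by blast
      then show ?thesis using Hwc[OF T(1)] by blast
    qed
    then show "(\<lambda>x\<in>U. x) \<in> tauM U w closure_of Hwc U w"
      using top unfolding in_closure_of by blast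
  next
    assume "(\<lambda>x\<in>U. x) \<in> tauM U w closure_of Hwc U w"
    then show "compact_approximation_property TYPE('a)"
      unfolding compact_approximation_property_def
      using tauM_closure_imp_compact_approximation[OF assms(1) \<open>0 \<in> U\<close> assms(4) _ I] by blast
  qed
qed

end
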